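(* Let $G$ be a finite directed graph with a global sink $s$, with a fixed cyclic ordering of the outgoing edges at each non-sink vertex. Fix any oriented spanning tree $\rho$ of $G$ rooted at the sink, regarded as an acyclic rotor configuration. Then for every oriented spanning tree $\rho'$ of $G$ rooted at the sink there is a unique recurrent chip configuration $\sigma$ on $G$ with $\sigma(\rho)=\rho'$, and the correspondence $\sigma\leftrightarrow\rho'=\sigma(\rho)$ is a bijection between the recurrent chip configurations of $G$ and the oriented spanning trees of $G$ rooted at the sink; under it, $\rho$ corresponds to the recurrent chip configuration $I$ that is the identity element of the sandpile group.
   Context: Directed graphs are finite; self-loops and multiple edges are allowed. A sink is a vertex of out-degree zero; a global sink is a sink $s$ such that from every other vertex there is a directed path leading to $s$. Let $n$ be the number of vertices, $d_v$ the out-degree of $v$ and $a_{vw}$ the number of edges from $v$ to $w$. Chip-firing: a chip configuration is a vector $\sigma$ of non-negative integers indexed by the non-sink vertices. A non-sink vertex $v$ is active in $\sigma$ if $\sigma(v)\ge d_v$; an active vertex can fire, giving $\sigma'$ with $\sigma'(w)=\sigma(w)+a_{vw}$ for non-sink $w\neq v$ and $\sigma'(v)=\sigma(v)-d_v+a_{vv}$. A configuration is stable if no vertex is active. A chip configuration $\sigma$ is accessible if from any other chip configuration it is possible to obtain $\sigma$ by a combination of adding chips and selectively firing active vertices. A chip configuration that is both stable and accessible is called recurrent. The reduced Laplacian $\Delta'$ is the matrix indexed by non-sink vertices with $\Delta'_{vw}=-a_{vw}$ for $v\ne w$ and $\Delta'_{vv}=d_v-a_{vv}$. The sandpile group is $\mathbb{Z}^{n-1}/\mathbb{Z}^{n-1}\Delta'$;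 each class contains exactly one recurrent chip configuration, and $I$ denotes the one in the class of $0$. Rotor-routing: for each non-sink vertex $v$ a cyclic ordering of the edges emanating from $v$ is fixed, and $e^+$ denotes the edge following $e$ in it. A rotor configuration is a function $\rho$ assigning to each non-sink vertex $v$ an edge $\rho(v)$ emanating from $v$. It is acyclic if the edges $\rho(v)$ do not form any directed cycle. An oriented spanning tree rooted at the sink is an acyclic subgraph in which every non-sink vertex has out-degree $1$; these are identified with acyclic rotor configurations. Routing a chip at a non-sink vertex $v$ for one step means replacing $\rho(v)$ by $\rho(v)^+$ and then moving the chip to the head of $\rho(v)^+$. For a non-sink vertex $v$, the chip addition operator $E_v$ is the map on rotor configurations given by adding a chip at $v$ and routing it repeatedly until it reaches the sink (which always happens after finitely many steps). The operators $E_v$ commute. For a chip configuration $\sigma$, $\sigma(\rho)=\left(\prod_{v\neq s}E_v^{\sigma(v)}\right)\rho$ (composition of operators). *)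

theory Defs
  imports
    "Graph_Theory.Digraph_Component"
    "HOL-Algebra.Product_Groups"
    "HOL-Combinatorics.Orbits"
    "HOL-Library.While_Combinator"
begin

definition nonsinks :: "('a,'b) pre_digraph \<Rightarrow> 'a set" where
  "nonsinks G = {v \<in> verts G. out_degree G v \<noteq> 0}"

definition global_sink :: "('a,'b) pre_digraph \<Rightarrow> 'a \<Rightarrow> bool" where
  "global_sink G s \<longleftrightarrow>
     s \<in> verts G \<and> out_degree G s = 0 \<and> (\<forall>v \<in> verts G - {s}. reachable G v s)"

definition arc_mult :: "('a,'b) pre_digraph \<Rightarrow> 'a \<Rightarrow> 'a \<Rightarrow> nat" where
  "arc_mult G v w = card {e \<in> arcs G. tail G e = v \<and> head G e = w}"

text \<open>Vectors of naturals indexed by the non-sink vertices, extended by \<open>0\<close> elsewhere.\<close>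

definition chip_configs :: "('a,'b) pre_digraph \<Rightarrow> ('a \<Rightarrow> nat) set" where
  "chip_configs G = {\<sigma>. \<forall>v. v \<notin> nonsinks G \<longrightarrow> \<sigma> v = 0}"

definition active :: "('a,'b) pre_digraph \<Rightarrow> ('a \<Rightarrow> nat) \<Rightarrow> 'a \<Rightarrow> bool" where
  "active G \<sigma> v \<longleftrightarrow> v \<in> nonsinks G \<and> out_degree G v \<le> \<sigma> v"

definition fire :: "('a,'b) pre_digraph \<Rightarrow> 'a \<Rightarrow> ('a \<Rightarrow> nat) \<Rightarrow> ('a \<Rightarrow> nat)" where
  "fire G v \<sigma> = (\<lambda>w.
     if w = v then \<sigma> v - out_degree G v + arc_mult G v v
     else if w \<in> nonsinks G then \<sigma> w + arc_mult G v w
     else 0)"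

definition stable :: "('a,'b) pre_digraph \<Rightarrow> ('a \<Rightarrow> nat) \<Rightarrow> bool" where
  "stable G \<sigma> \<longleftrightarrow> (\<forall>v. \<not> active G \<sigma> v)"

inductive chip_move :: "('a,'b) pre_digraph \<Rightarrow> ('a \<Rightarrow> nat) \<Rightarrow> ('a \<Rightarrow> nat) \<Rightarrow> bool"
  for G where
  add_chip: "v \<in> nonsinks G \<Longrightarrow> chip_move G \<sigma> (\<sigma>(v := \<sigma> v + 1))"
| fire_active: "active G \<sigma> v \<Longrightarrow> chip_move G \<sigma> (fire G v \<sigma>)"

definition accessible :: "('a,'b) pre_digraph \<Rightarrow> ('a \<Rightarrow> nat) \<Rightarrow> bool" where
  "accessible G \<sigma> \<longleftrightarrow> (\<forall>\<tau> \<in> chip_configs G. (chip_move G)\<^sup>*\<^sup>* \<tau> \<sigma>)"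

definition recurrent_configs :: "('a,'b) pre_digraph \<Rightarrow> ('a \<Rightarrow> nat) set" where
  "recurrent_configs G = {\<sigma> \<in> chip_configs G. stable G \<sigma> \<and> accessible G \<sigma>}"

definition reduced_laplacian :: "('a,'b) pre_digraph \<Rightarrow> 'a \<Rightarrow> 'a \<Rightarrow> int" where
  "reduced_laplacian G v w =
     (if v = w then int (out_degree G v) - int (arc_mult G v v) else - int (arc_mult G v w))"

abbreviation int_vectors :: "('a,'b) pre_digraph \<Rightarrow> ('a \<Rightarrow> int) monoid" where
  "int_vectors G \<equiv> product_group (nonsinks G) (\<lambda>_. integer_group)"

text \<open>Row vectors times the matrix, i.e. the lattice spanned by the rows of the reduced Laplacian.\<close>

definition laplacian_lattice :: "('a,'b) pre_digraph \<Rightarrow> ('a \<Rightarrow> int) set" where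
  "laplacian_lattice G =
     (\<lambda>x. \<lambda>w \<in> nonsinks G. \<Sum>v \<in> nonsinks G. x v * reduced_laplacian G v w)
       ` carrier (int_vectors G)"

definition sandpile_group :: "('a,'b) pre_digraph \<Rightarrow> ('a \<Rightarrow> int) set monoid" where
  "sandpile_group G = int_vectors G Mod laplacian_lattice G"

definition sandpile_class :: "('a,'b) pre_digraph \<Rightarrow> ('a \<Rightarrow> nat) \<Rightarrow> ('a \<Rightarrow> int) set" where
  "sandpile_class G \<sigma> = laplacian_lattice G #>\<^bsub>int_vectors G\<^esub> (\<lambda>v \<in> nonsinks G. int (\<sigma> v))"

definition recurrent_identity :: "('a,'b) pre_digraph \<Rightarrow> ('a \<Rightarrow> nat)" where
  "recurrent_identity G =
     (THE \<sigma>. \<sigma> \<in> recurrent_configs G \<and> sandpile_class G \<sigma> = \<one>\<^bsub>sandpile_group G\<^esub>)"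

text \<open>The argument \<open>nxt\<close> maps an edge \<open>e\<close> to \<open>e\<^sup>+\<close>.\<close>

definition rotor_order :: "('a,'b) pre_digraph \<Rightarrow> ('b \<Rightarrow> 'b) \<Rightarrow> bool" where
  "rotor_order G nxt \<longleftrightarrow> (\<forall>v \<in> nonsinks G. cyclic_on nxt (out_arcs G v))"

definition rotor_configs :: "('a,'b) pre_digraph \<Rightarrow> ('a \<Rightarrow> 'b) set" where
  "rotor_configs G = (\<Pi>\<^sub>E v \<in> nonsinks G. out_arcs G v)"

definition rotor_graph :: "('a,'b) pre_digraph \<Rightarrow> ('a \<Rightarrow> 'b) \<Rightarrow> ('a,'b) pre_digraph" where
  "rotor_graph G \<rho> = G\<lparr>arcs := \<rho> ` nonsinks G\<rparr>"

definition acyclic_rotor_configs :: "('a,'b) pre_digraph \<Rightarrow> ('a \<Rightarrow> 'b) set" where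
  "acyclic_rotor_configs G =
     {\<rho> \<in> rotor_configs G. \<nexists>p. pre_digraph.cycle (rotor_graph G \<rho>) p}"

definition oriented_spanning_tree :: "('a,'b) pre_digraph \<Rightarrow> ('a,'b) pre_digraph \<Rightarrow> bool" where
  "oriented_spanning_tree G T \<longleftrightarrow>
     spanning T G \<and> (\<forall>v \<in> nonsinks G. out_degree T v = 1) \<and> (\<nexists>p. pre_digraph.cycle T p)"

text \<open>Acyclic rotor configurations are the oriented spanning trees.\<close>

lemma bij_betw_rotor_graph:
  assumes "fin_digraph G"
  shows "bij_betw (rotor_graph G) (acyclic_rotor_configs G) {T. oriented_spanning_tree G T}"
proof -
  interpret fin_digraph G by fact
  have out: "out_arcs (rotor_graph G \<rho>) v = {\<rho> v}"
    if "\<rho> \<in> rotor_configs G" "v \<in> nonsinks G" for \<rho> v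
    using that by (auto simp: rotor_configs_def rotor_graph_def out_arcs_def PiE_iff)
  show ?thesis
  proof (rule bij_betw_imageI)
    show "inj_on (rotor_graph G) (acyclic_rotor_configs G)"
    proof (rule inj_onI)
      fix \<rho> \<rho>' assume *: "\<rho> \<in> acyclic_rotor_configs G" "\<rho>' \<in> acyclic_rotor_configs G"
        "rotor_graph G \<rho> = rotor_graph G \<rho>'"
      then have "\<rho> \<in> rotor_configs G" "\<rho>' \<in> rotor_configs G"
        by (auto simp: acyclic_rotor_configs_def)
      moreover from this have "\<rho> v = \<rho>' v" if "v \<in> nonsinks G" for v
        using out[of \<rho> v] out[of \<rho>' v] that *(3) by simp
      ultimately show "\<rho> = \<rho>'"
        unfolding rotor_configs_def by (auto intro: PiE_ext)
    qed
  next
    show "rotor_graph G ` acyclic_rotor_configs G = {T. oriented_spanning_tree G T}"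
    proof (intro equalityI subsetI)
      fix T assume "T \<in> rotor_graph G ` acyclic_rotor_configs G"
      then obtain \<rho> where T: "T = rotor_graph G \<rho>" and \<rho>: "\<rho> \<in> rotor_configs G"
        and ac: "\<nexists>p. pre_digraph.cycle T p"
        by (auto simp: acyclic_rotor_configs_def)
      have sub: "\<rho> ` nonsinks G \<subseteq> arcs G"
        using \<rho> by (auto simp: rotor_configs_def PiE_iff)
      then have "wf_digraph T"
        unfolding T rotor_graph_def by unfold_locales auto
      then have "spanning T G"
        using sub wf_digraph unfolding spanning_def subgraph_def compatible_def
        by (auto simp: T rotor_graph_def)
      moreover have "out_degree T v = 1" if "v \<in> nonsinks G" for v
        using out[OF \<rho> that] by (simp add: T out_degree_def)
      ultimately show "T \<in> {T. oriented_spanning_tree G T}"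
        using ac by (simp add: oriented_spanning_tree_def)
    next
      fix T assume "T \<in> {T. oriented_spanning_tree G T}"
      then have sp: "spanning T G" and deg: "\<forall>v \<in> nonsinks G. out_degree T v = 1"
        and ac: "\<nexists>p. pre_digraph.cycle T p"
        by (auto simp: oriented_spanning_tree_def)
      from sp have T: "verts T = verts G" "arcs T \<subseteq> arcs G" "tail T = tail G" "head T = head G"
        by (auto simp: spanning_def subgraph_def compatible_def)
      have "\<forall>v \<in> nonsinks G. \<exists>e. out_arcs T v = {e}"
        using deg by (auto simp: out_degree_def card_1_singleton_iff)
      then obtain f where f: "\<And>v. v \<in> nonsinks G \<Longrightarrow> out_arcs T v = {f v}"
        by metis
      define \<rho> where "\<rho> = restrict f (nonsinks G)"
      have fv: "f v \<in> arcs T \<and> tail G (f v) = v" if "v \<in> nonsinks G" for v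
      proof -
        have "f v \<in> out_arcs T v" using f[OF that] by simp
        then show ?thesis by (simp add: out_arcs_def T)
      qed
      have "\<rho> ` nonsinks G = arcs T"
      proof (intro equalityI subsetI)
        fix e assume e: "e \<in> arcs T"
        then have "tail G e \<in> nonsinks G"
          using T(2) finite_out_arcs[of "tail G e"]
          by (auto simp: nonsinks_def out_degree_def out_arcs_def)
        moreover from this e have "e = f (tail G e)"
          using f[of "tail G e"] T(3) by (auto simp: out_arcs_def)
        ultimately show "e \<in> \<rho> ` nonsinks G" by (auto simp: \<rho>_def)
      qed (auto simp: \<rho>_def fv)
      then have eq: "T = rotor_graph G \<rho>"
        using T by (simp add: rotor_graph_def)
      have "\<rho> \<in> rotor_configs G"
        using fv T(2) by (auto simp: rotor_configs_def \<rho>_def PiE_iff)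
      then show "T \<in> rotor_graph G ` acyclic_rotor_configs G"
        using ac unfolding eq by (auto simp: acyclic_rotor_configs_def)
    qed
  qed
qed

definition route_step ::
  "('a,'b) pre_digraph \<Rightarrow> ('b \<Rightarrow> 'b) \<Rightarrow> 'a \<times> ('a \<Rightarrow> 'b) \<Rightarrow> 'a \<times> ('a \<Rightarrow> 'b)" where
  "route_step G nxt = (\<lambda>(v, \<rho>). (head G (nxt (\<rho> v)), \<rho>(v := nxt (\<rho> v))))"

text \<open>
  The operator is extended by the identity outside the rotor configurations, so that commutation
  on rotor configurations is commutation of functions on the whole type, as
  \<^const>\<open>Finite_Set.fold\<close> expects.
\<close>

definition chip_addition ::
  "('a,'b) pre_digraph \<Rightarrow> 'a \<Rightarrow> ('b \<Rightarrow> 'b) \<Rightarrow> 'a \<Rightarrow> ('a \<Rightarrow> 'b) \<Rightarrow> ('a \<Rightarrow> 'b)" where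
  "chip_addition G s nxt v \<rho> =
     (if \<rho> \<in> rotor_configs G
      then snd (while (\<lambda>(u, _). u \<noteq> s) (route_step G nxt) (v, \<rho>))
      else \<rho>)"

definition chip_action ::
  "('a,'b) pre_digraph \<Rightarrow> 'a \<Rightarrow> ('b \<Rightarrow> 'b) \<Rightarrow> ('a \<Rightarrow> nat) \<Rightarrow> ('a \<Rightarrow> 'b) \<Rightarrow> ('a \<Rightarrow> 'b)" where
  "chip_action G s nxt \<sigma> \<rho> =
     Finite_Set.fold (\<lambda>v. chip_addition G s nxt v ^^ \<sigma> v) \<rho> (verts G - {s})"

end

theory Submission
  imports Defs "HOL-Library.Confluence" "HOL-Library.Function_Algebras"
begin

text \<open>
  Chip-firing and rotor-routing are both confluent, and a firing of \<open>v\<close> amounts to one full turn of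
  the rotor at \<open>v\<close>; so the action of a chip configuration is unchanged by stabilisation. If \<open>\<sigma>\<close> and \<open>\<tau>\<close>
  act on \<open>\<rho>\<close> with the same result, the numbers of steps taken at \<open>v\<close> differ by a number of full
  turns, and counting chips shows that \<open>\<sigma> - \<tau>\<close> lies in the Laplacian lattice; since a class contains
  at most one recurrent configuration, the correspondence is injective. For surjectivity, rotate \<open>\<rho>\<close>
  into \<open>\<rho>'\<close> by giving each vertex as many chips \<open>\<alpha>\<close> as its rotor needs steps; the displaced chips
  \<open>\<beta>\<close> satisfy \<open>\<alpha>(\<rho>) = \<beta>(\<rho>')\<close>. Every chip configuration permutes the finite set of spanning trees,
  so adding suitable chips to \<open>\<alpha>\<close> undoes \<open>\<beta>\<close>, with as many more chips as needed for the
  stabilisation to be recurrent.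
\<close>

section \<open>Iterates of a function\<close>

text \<open>The total number of chips is no invariant, since chips vanish at the sink. In its place
  stand weights by test functions that vanish there. One identity, that a full turn of the rotor at
  \<open>v\<close> changes \<open>weight \<phi>\<close> by \<open>drift \<phi> v\<close>, serves two
  purposes: indicators turn differences of odometers into lattice vectors, and a superharmonic
  \<phi>, whose drift is negative at every non-sink vertex, makes firing and the walk of a chip
  terminate. Acyclicity is what allows \<beta> to be undone. A single vertex with a loop and an edge
  to the sink has two rotor configurations, and adding a chip sends both to the tree. Injectivity is
  therefore proved for the single steps of the walk, on unicycles, and passed on to the operator as
  a first-return map.\<close>

lemma cyclic_on_imp_bij_betw:
  assumes "cyclic_on f S"
  shows "bij_betw f S S"
proof -
  have "S \<subseteq> f ` S"
  proof
    fix y assume y: "y \<in> S"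
    then have "y \<in> orbit f y" "orbit f y = S"
      using orbit_cyclic_eq3[OF assms] by auto
    then show "y \<in> f ` S"
      using y by (metis image_eqI orbit.cases)
  qed
  moreover have "f ` S \<subseteq> S"
    using cyclic_on_inI[OF assms] by auto
  ultimately show ?thesis
    using finite_cyclic_on[OF assms] by (simp add: bij_betw_def eq_card_imp_inj_on)
qed

text \<open>The index is shifted by one because a rotor advances before the chip moves: the chip
  sent by step \<open>j\<close>, counted from \<open>0\<close>, travels along
  \<open>(f ^^ Suc j) x\<close>. A full turn uses every edge once.\<close>

lemma bij_betw_funpow_cyclic_on:
  assumes "cyclic_on f S" "x \<in> S"
  shows "(f ^^ card S) x = x" and "bij_betw (\<lambda>j. (f ^^ Suc j) x) {..<card S} S"
proof -
  let ?n = "funpow_dist1 f x x"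
  have orb: "orbit f x = S" and x: "x \<in> orbit f x"
    using orbit_cyclic_eq3[OF assms] assms by auto
  have b: "bij_betw (\<lambda>j. (f ^^ j) x) {0..<?n} S"
    using inj_on_funpow_dist1[OF x] orbit_conv_funpow_dist1[OF x] orb by (simp add: bij_betw_def)
  have n: "card S = ?n"
    using bij_betw_same_card[OF b] by simp
  show "(f ^^ card S) x = x"
    using funpow_dist1_prop[OF x] n by simp
  from bij_betw_trans[OF b cyclic_on_imp_bij_betw[OF assms(1)]]
  show "bij_betw (\<lambda>j. (f ^^ Suc j) x) {..<card S} S"
    by (simp add: comp_def n atLeast0LessThan)
qed

lemma sum_funpow_cyclic:
  fixes g :: "'b \<Rightarrow> int"
  assumes "cyclic_on f S" "x \<in> S"
  shows "(\<Sum>j<b + m * card S. g ((f ^^ Suc j) x)) = (\<Sum>j<b. g ((f ^^ Suc j) x)) + int m * sum g S"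
proof (induction m)
  case (Suc m)
  let ?k = "b + m * card S" and ?y = "(f ^^ (b + m * card S)) x"
  have y: "?y \<in> S"
    using cyclic_on_funpow_in assms by metis
  have split: "sum h {..<k + l} = sum h {..<k} + (\<Sum>j<l. h (k + j))" for h :: "nat \<Rightarrow> int" and k l
    by (induction l) (auto simp: add.assoc)
  have "b + Suc m * card S = ?k + card S"
    by simp
  then have "(\<Sum>j<b + Suc m * card S. g ((f ^^ Suc j) x))
      = (\<Sum>j<?k. g ((f ^^ Suc j) x)) + (\<Sum>j<card S. g ((f ^^ Suc (?k + j)) x))"
    by (simp only: split)
  also have "(\<Sum>j<card S. g ((f ^^ Suc (?k + j)) x)) = (\<Sum>j<card S. g ((f ^^ Suc j) ?y))"
    by (rule sum.cong) (simp_all add: funpow_add add.commute[of ?k])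
  also have "\<dots> = sum g S"
    using bij_betw_funpow_cyclic_on(2)[OF assms(1) y] by (rule sum.reindex_bij_betw)
  finally show ?case
    using Suc by (simp add: algebra_simps)
qed simp

lemma funpow_cyclic_eqD:
  assumes "cyclic_on f S" "x \<in> S" "(f ^^ a) x = (f ^^ b) x" "b \<le> a"
  shows "\<exists>m. a = b + m * card S"
proof -
  let ?n = "card S" and ?y = "(f ^^ b) x"
  have y: "?y \<in> S"
    using cyclic_on_funpow_in assms by metis
  have pos: "?n > 0"
    using assms finite_cyclic_on by (metis card_gt_0_iff empty_iff)
  have "(f ^^ (a - b)) ?y = ?y"
    using assms(3,4) by (metis comp_apply funpow_add le_add_diff_inverse2)
  then have mod: "(f ^^ ((a - b) mod ?n)) ?y = ?y"
    using funpow_mod_eq[OF bij_betw_funpow_cyclic_on(1)[OF assms(1) y]] by metis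
  have "(a - b) mod ?n = 0"
  proof (rule ccontr)
    assume ne: "(a - b) mod ?n \<noteq> 0"
    then obtain i where i: "(a - b) mod ?n = Suc i"
      by (cases "(a - b) mod ?n") auto
    then have "Suc i < ?n"
      using pos mod_less_divisor by metis
    \<comment> \<open>Both the full turn and the nonzero remainder bring \<open>?y\<close> back, so
      the distinct indices \<open>?n - 1\<close> and \<open>i\<close> collide.\<close>
    moreover have "(f ^^ Suc (?n - 1)) ?y = (f ^^ Suc i) ?y"
      using mod i bij_betw_funpow_cyclic_on(1)[OF assms(1) y] pos by simp
    ultimately show False
      using bij_betw_funpow_cyclic_on(2)[OF assms(1) y] unfolding bij_betw_def inj_on_def
      by (metis Suc_lessD Suc_diff_1 diff_less lessThan_iff less_irrefl pos zero_less_one)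
  qed
  then show ?thesis
    using assms(4) by (metis add.commute div_mult_mod_eq le_add_diff_inverse2 add_0 add.right_neutral)
qed

text \<open>The integer \<open>c\<close>, a difference in full turns, is chosen before
  \<open>g\<close>: one coefficient per vertex has to serve all test functions.\<close>

lemma sum_funpow_cyclic_diff:
  assumes "cyclic_on f S" "x \<in> S" "(f ^^ a) x = (f ^^ b) x"
  shows "\<exists>c. \<forall>g :: 'b \<Rightarrow> int.
    (\<Sum>j<a. g ((f ^^ Suc j) x)) - (\<Sum>j<b. g ((f ^^ Suc j) x)) = c * sum g S"
proof (cases "b \<le> a")
  case True
  then obtain m where "a = b + m * card S"
    using funpow_cyclic_eqD[OF assms(1,2)] assms(3) by blast
  then show ?thesis
    using sum_funpow_cyclic[OF assms(1,2)] by (intro exI[of _ "int m"]) simp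
next
  case False
  then obtain m where "b = a + m * card S"
    using funpow_cyclic_eqD[OF assms(1,2), of b a] assms(3) by force
  then show ?thesis
    using sum_funpow_cyclic[OF assms(1,2)] by (intro exI[of _ "- int m"]) simp
qed

lemma inj_on_funpow_self:
  assumes "inj_on f S" "f \<in> S \<rightarrow> S"
  shows "inj_on (f ^^ n) S"
proof (induction n)
  case (Suc n)
  have "(f ^^ n) ` S \<subseteq> S"
    using assms(2) by (induction n) auto
  then show ?case
    unfolding funpow.simps using Suc assms(1) by (meson comp_inj_on inj_on_subset)
qed simp

text \<open>Injectivity turns a repetition in the orbit of \<open>x\<close> into a return to
  \<open>x\<close> itself.\<close>

lemma funpow_self_return:
  assumes "inj_on f S" "f \<in> S \<rightarrow> S" "finite S" "x \<in> S"
  shows "\<exists>m>0. (f ^^ m) x = x"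
proof -
  have S: "(f ^^ i) x \<in> S" for i
    using assms by (induction i) auto
  then have "\<not> inj (\<lambda>i. (f ^^ i) x)"
    using assms(3) by (metis finite_imageD finite_subset image_subsetI infinite_UNIV_nat)
  then obtain i j where ij: "i < j" "(f ^^ i) x = (f ^^ j) x"
    unfolding inj_def by (metis linorder_neqE_nat)
  then have "(f ^^ i) ((f ^^ (j - i)) x) = (f ^^ i) x"
    by (metis comp_apply funpow_add le_add_diff_inverse less_imp_le)
  then have "(f ^^ (j - i)) x = x"
    using inj_onD[OF inj_on_funpow_self[OF assms(1,2)]] S assms(4) by blast
  then show ?thesis
    using ij(1) by (intro exI[of _ "j - i"]) simp
qed

text \<open>Cut the path at its first visit to \<open>u\<close>; the part before never consults the
  value of \<open>f\<close> at \<open>u\<close>.\<close>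

lemma funpow_reach_fun_upd:
  assumes "(f ^^ k) x = u"
  shows "\<exists>k. ((f(u := w)) ^^ k) x = u"
  using assms
proof (induction k arbitrary: x)
  case (Suc k)
  show ?case
  proof (cases "x = u")
    case False
    have "(f ^^ k) (f x) = u"
      using Suc.prems by (simp add: funpow_swap1)
    then obtain k' where "((f(u := w)) ^^ k') (f x) = u"
      using Suc.IH by blast
    then show ?thesis
      using False by (metis comp_apply fun_upd_other funpow_Suc_right)
  qed (auto intro: exI[of _ 0])
qed (auto intro: exI[of _ 0])

text \<open>Both points lie on the cycle through \<open>w\<close>, where they are the predecessor of \<open>w\<close>.\<close>

lemma funpow_cycle_predecessor_unique:
  assumes "(f ^^ a) w = u" "f u = w" "(f ^^ b) w = v" "f v = w"
  shows "u = v"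
proof -
  have *: "(f ^^ (m * Suc k)) w = w" if "(f ^^ Suc k) w = w" for m k
    using that by (metis funpow_mod_eq mod_mult_self2_is_0 funpow_0)
  \<comment> \<open>\<open>Suc a\<close> and \<open>Suc b\<close> are periods of \<open>w\<close>.
    Both exponents equal \<open>Suc a * Suc b - 1\<close>, one step short of a common
    period.\<close>
  have "(f ^^ (a + b * Suc a)) w = u"
    unfolding funpow_add using *[of a b] assms by simp
  moreover have "(f ^^ (b + a * Suc b)) w = v"
    unfolding funpow_add using *[of b a] assms by simp
  moreover have "a + b * Suc a = b + a * Suc b"
    by simp
  ultimately show ?thesis
    by metis
qed

section \<open>Chip-firing\<close>

locale sink_digraph = fin_digraph G for G :: "('a,'b) pre_digraph" +
  fixes s :: 'a
  assumes sink: "global_sink G s"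
begin

abbreviation N :: "'a set" where "N \<equiv> nonsinks G"

abbreviation deg :: "'a \<Rightarrow> nat" where "deg \<equiv> out_degree G"

text \<open>A pile at the sink is empty, since chips that reach the sink disappear.\<close>

definition chips :: "nat \<Rightarrow> 'a \<Rightarrow> 'a \<Rightarrow> nat" where
  "chips k v = (\<lambda>w. if w = v \<and> v \<in> N then k else 0)"

text \<open>Written as a sum over edges so that it can be compared with the steps of a full rotor
  turn; \<open>spread_apply\<close> recovers the multiplicities.\<close>

definition spread :: "'a \<Rightarrow> 'a \<Rightarrow> nat" where
  "spread v = (\<Sum>e\<in>out_arcs G v. chips 1 (head G e))"

text \<open>Splitting off the chips that are spent replaces the truncated subtraction in
  \<open>fire\<close>, so that adding chips and exchanging firings become computations in a
  commutative monoid.\<close>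

definition firing :: "('a \<Rightarrow> nat) \<Rightarrow> ('a \<Rightarrow> nat) \<Rightarrow> bool" where
  "firing \<sigma> \<tau> \<longleftrightarrow> (\<exists>\<kappa>\<in>chip_configs G. \<exists>v\<in>N. \<sigma> = \<kappa> + chips (deg v) v \<and> \<tau> = \<kappa> + spread v)"

lemma finite_N [simp]: "finite N"
  by (simp add: nonsinks_def)

lemma N_eq: "N = verts G - {s}"
proof -
  have "deg v \<noteq> 0" if "v \<in> verts G - {s}" for v
  proof -
    have "reachable G v s" "v \<noteq> s"
      using sink that by (auto simp: global_sink_def)
    then obtain w where "(v, w) \<in> arcs_ends G"
      by (metis converse_reachable_cases)
    then have "out_arcs G v \<noteq> {}"
      by (auto simp: arcs_ends_def arc_to_ends_def)
    then show ?thesis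
      by (simp add: out_degree_def card_gt_0_iff finite_out_arcs)
  qed
  then show ?thesis
    using sink by (auto simp: nonsinks_def global_sink_def)
qed

lemma s_notin_N [simp]: "s \<notin> N" and s_in_verts [simp]: "s \<in> verts G"
  using sink by (auto simp: N_eq global_sink_def)

lemma chips_add: "chips k v + chips l v = chips (k + l) v"
  by (auto simp: chips_def fun_eq_iff)

lemma chips_sink [simp]: "chips k s = 0"
  by (auto simp: chips_def fun_eq_iff)

lemma chips_0 [simp]: "chips 0 v = 0"
  by (auto simp: chips_def fun_eq_iff)

lemma chips_in [simp]: "chips k v \<in> chip_configs G"
  by (auto simp: chips_def chip_configs_def)

lemma zero_in [simp]: "0 \<in> chip_configs G"
  by (auto simp: chip_configs_def)

lemma add_in [simp]: "\<sigma> \<in> chip_configs G \<Longrightarrow> \<tau> \<in> chip_configs G \<Longrightarrow> \<sigma> + \<tau> \<in> chip_configs G"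
  by (auto simp: chip_configs_def)

lemma sum_in: "(\<And>i. i \<in> I \<Longrightarrow> f i \<in> chip_configs G) \<Longrightarrow> sum f I \<in> chip_configs G"
  by (induction I rule: infinite_finite_induct) auto

lemma spread_in [simp]: "spread v \<in> chip_configs G"
  by (simp add: spread_def sum_in)

lemma le_chip_configs_ex_add:
  assumes "\<tau> \<in> chip_configs G" "\<And>v. v \<in> N \<Longrightarrow> \<sigma> v \<le> \<tau> v" "\<sigma> \<in> chip_configs G"
  shows "\<exists>\<kappa>\<in>chip_configs G. \<tau> = \<kappa> + \<sigma>"
proof
  show "\<tau> = (\<lambda>v. \<tau> v - \<sigma> v) + \<sigma>"
  proof
    fix v show "\<tau> v = ((\<lambda>v. \<tau> v - \<sigma> v) + \<sigma>) v"
      using assms by (cases "v \<in> N") (auto simp: chip_configs_def)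
  qed
  show "(\<lambda>v. \<tau> v - \<sigma> v) \<in> chip_configs G"
    using assms by (auto simp: chip_configs_def)
qed

lemma ex_add_chips:
  assumes "\<tau> \<in> chip_configs G" "v \<in> N" "k \<le> \<tau> v"
  shows "\<exists>\<kappa>\<in>chip_configs G. \<tau> = \<kappa> + chips k v"
  by (rule le_chip_configs_ex_add[OF assms(1) _ chips_in]) (use assms in \<open>auto simp: chips_def\<close>)

lemma sum_fun_apply: "(\<Sum>i\<in>I. f i) x = (\<Sum>i\<in>I. f i x)" for f :: "'i \<Rightarrow> 'a \<Rightarrow> nat"
  by (induction I rule: infinite_finite_induct) auto

lemma spread_apply: "spread v w = (if w \<in> N then arc_mult G v w else 0)"
proof (cases "w \<in> N")
  case True
  then have "spread v w = (\<Sum>e\<in>out_arcs G v. of_bool (head G e = w))"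
    unfolding spread_def sum_fun_apply by (intro sum.cong) (auto simp: chips_def)
  also have "\<dots> = card {e \<in> out_arcs G v. head G e = w}"
    by (subst sum_of_bool_eq) (simp_all add: Int_def finite_out_arcs del: in_out_arcs_conv)
  also have "{e \<in> out_arcs G v. head G e = w} = {e \<in> arcs G. tail G e = v \<and> head G e = w}"
    by auto
  finally show ?thesis
    using True by (simp add: arc_mult_def)
qed (use spread_in[of v] in \<open>simp add: chip_configs_def\<close>)

lemma fire_add_chips:
  assumes "\<kappa> \<in> chip_configs G" "v \<in> N"
  shows "fire G v (\<kappa> + chips (deg v) v) = \<kappa> + spread v"
  using assms by (auto simp: fire_def chips_def spread_apply fun_eq_iff chip_configs_def)

lemma firing_fire:
  assumes "active G \<sigma> v" "\<sigma> \<in> chip_configs G"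
  shows "firing \<sigma> (fire G v \<sigma>)"
proof -
  from assms obtain \<kappa> where "\<kappa> \<in> chip_configs G" "\<sigma> = \<kappa> + chips (deg v) v"
    using ex_add_chips[of \<sigma> v "deg v"] by (auto simp: active_def)
  then show ?thesis
    using assms fire_add_chips[of \<kappa> v] by (auto simp: firing_def active_def)
qed

lemma firing_imp_chip_move: "firing \<sigma> \<tau> \<Longrightarrow> chip_move G \<sigma> \<tau>"
proof -
  assume "firing \<sigma> \<tau>"
  then obtain \<kappa> v where *: "\<kappa> \<in> chip_configs G" "v \<in> N" "\<sigma> = \<kappa> + chips (deg v) v" "\<tau> = \<kappa> + spread v"
    by (auto simp: firing_def)
  then have "active G \<sigma> v"
    by (simp add: active_def chips_def)
  then show ?thesis
    using fire_active[of G \<sigma> v] fire_add_chips[OF *(1,2)] *(3,4) by simp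
qed

lemma stable_not_firing: "stable G \<sigma> \<Longrightarrow> \<not> firing \<sigma> \<tau>"
  by (auto simp: firing_def stable_def active_def chips_def)

lemma firing_in:
  assumes "firing \<sigma> \<tau>"
  shows "\<sigma> \<in> chip_configs G" "\<tau> \<in> chip_configs G"
  using assms by (auto simp: firing_def)

lemma firings_in: "firing\<^sup>*\<^sup>* \<sigma> \<tau> \<Longrightarrow> \<sigma> \<in> chip_configs G \<Longrightarrow> \<tau> \<in> chip_configs G"
  by (induction rule: rtranclp_induct) (auto dest: firing_in)

lemma firing_add:
  assumes "firing \<sigma> \<tau>" "\<kappa> \<in> chip_configs G"
  shows "firing (\<sigma> + \<kappa>) (\<tau> + \<kappa>)"
proof -
  obtain \<kappa>' v where "\<kappa>' \<in> chip_configs G" "v \<in> N" "\<sigma> = \<kappa>' + chips (deg v) v" "\<tau> = \<kappa>' + spread v"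
    using assms by (auto simp: firing_def)
  then show ?thesis
    unfolding firing_def using assms(2)
    by (intro bexI[of _ "\<kappa>' + \<kappa>"] bexI[of _ v]) (auto simp: ac_simps)
qed

lemma firings_add:
  assumes "firing\<^sup>*\<^sup>* \<sigma> \<tau>" "\<kappa> \<in> chip_configs G"
  shows "firing\<^sup>*\<^sup>* (\<sigma> + \<kappa>) (\<tau> + \<kappa>)"
  using assms(1)
proof (induction rule: rtranclp_induct)
  case (step y z)
  then show ?case
    by (metis firing_add[OF _ assms(2)] rtranclp.rtrancl_into_rtrancl)
qed simp

section \<open>Confluence of chip-firing\<close>

text \<open>Firing \<open>v\<close> takes chips from no other vertex, so another active vertex stays
  active and the two firings can be done in either order. The common part \<mu> is what remains when
  both vertices have paid their chips.\<close>

lemma confluentp_firing: "confluentp firing"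
proof (rule strong_confluentp_imp_confluentp, rule strong_confluentpI)
  fix x y z assume "firing x y" "firing x z"
  then obtain \<kappa> v \<kappa>' w where *: "\<kappa> \<in> chip_configs G" "v \<in> N" "x = \<kappa> + chips (deg v) v" "y = \<kappa> + spread v"
    "\<kappa>' \<in> chip_configs G" "w \<in> N" "x = \<kappa>' + chips (deg w) w" "z = \<kappa>' + spread w"
    by (auto simp: firing_def)
  show "\<exists>u. firing\<^sup>*\<^sup>* y u \<and> firing\<^sup>=\<^sup>= z u"
  proof (cases "v = w")
    case True
    then have "y = z"
      using * by (metis add_right_cancel)
    then show ?thesis by blast
  next
    case False
    have "deg w \<le> \<kappa> w"
    proof -
      have "(\<kappa> + chips (deg v) v) w = (\<kappa>' + chips (deg w) w) w"
        using * by simp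
      then show ?thesis
        using False *(6) by (simp add: chips_def)
    qed
    then obtain \<mu> where \<mu>: "\<mu> \<in> chip_configs G" "\<kappa> = \<mu> + chips (deg w) w"
      using ex_add_chips * by blast
    then have "\<kappa>' + chips (deg w) w = (\<mu> + chips (deg v) v) + chips (deg w) w"
      using * by (simp add: ac_simps)
    then have \<kappa>': "\<kappa>' = \<mu> + chips (deg v) v"
      by (metis add_right_cancel)
    have "firing y (\<mu> + spread v + spread w)"
      unfolding firing_def using \<mu> *
      by (intro bexI[of _ "\<mu> + spread v"] bexI[of _ w]) (auto simp: ac_simps)
    moreover have "firing z (\<mu> + spread v + spread w)"
      unfolding firing_def using \<mu> \<kappa>' *
      by (intro bexI[of _ "\<mu> + spread w"] bexI[of _ v]) (auto simp: ac_simps)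
    ultimately show ?thesis by blast
  qed
qed

lemma stabilization_unique:
  assumes "firing\<^sup>*\<^sup>* \<sigma> \<tau>" "stable G \<tau>" "firing\<^sup>*\<^sup>* \<sigma> \<tau>'" "stable G \<tau>'"
  shows "\<tau> = \<tau>'"
proof -
  obtain u where "firing\<^sup>*\<^sup>* \<tau> u" "firing\<^sup>*\<^sup>* \<tau>' u"
    using confluentpD[OF confluentp_firing] assms by blast
  then show ?thesis
    using assms stable_not_firing by (metis converse_rtranclpE)
qed

subsection \<open>Weights\<close>

text \<open>
  Test functions vanish outside the non-sinks. Conservation laws are stated against them; the
  indicator of \<open>w\<close> recovers the number of chips at \<open>w\<close>.
\<close>

definition tests :: "('a \<Rightarrow> int) set" where
  "tests = {\<phi>. \<forall>x. x \<notin> N \<longrightarrow> \<phi> x = 0}"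

definition weight :: "('a \<Rightarrow> int) \<Rightarrow> ('a \<Rightarrow> nat) \<Rightarrow> int" where
  "weight \<phi> \<sigma> = (\<Sum>w\<in>N. int (\<sigma> w) * \<phi> w)"

text \<open>A negated graph Laplacian applied to \<phi>: for a test function, the change of
  \<open>weight \<phi>\<close> when \<open>v\<close> fires.\<close>

definition drift :: "('a \<Rightarrow> int) \<Rightarrow> 'a \<Rightarrow> int" where
  "drift \<phi> v = (\<Sum>e\<in>out_arcs G v. \<phi> (head G e) - \<phi> v)"

lemma weight_add: "weight \<phi> (\<sigma> + \<tau>) = weight \<phi> \<sigma> + weight \<phi> \<tau>"
  by (simp add: weight_def sum.distrib algebra_simps)

lemma weight_0 [simp]: "weight \<phi> 0 = 0"
  by (simp add: weight_def)

lemma weight_chips: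
  assumes "\<phi> \<in> tests"
  shows "weight \<phi> (chips k v) = int k * \<phi> v"
proof -
  have "weight \<phi> (chips k v) = (\<Sum>w\<in>N. if w = v then int k * \<phi> v else 0)"
    unfolding weight_def by (rule sum.cong) (auto simp: chips_def)
  then show ?thesis
    using assms by (simp add: tests_def)
qed

lemma weight_spread:
  assumes "\<phi> \<in> tests"
  shows "weight \<phi> (spread v) = (\<Sum>e\<in>out_arcs G v. \<phi> (head G e))"
proof -
  have "weight \<phi> (sum f I) = (\<Sum>i\<in>I. weight \<phi> (f i))" for f :: "'b \<Rightarrow> 'a \<Rightarrow> nat" and I
    by (induction I rule: infinite_finite_induct) (simp_all add: weight_add del: plus_fun_apply zero_fun_apply)
  then show ?thesis
    by (simp add: spread_def weight_chips[OF assms])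
qed

lemma weight_firing:
  assumes "\<phi> \<in> tests"
  shows "weight \<phi> (\<kappa> + spread v) = weight \<phi> (\<kappa> + chips (deg v) v) + drift \<phi> v"
  by (simp add: weight_add weight_spread weight_chips assms drift_def sum_subtractf out_degree_def)

text \<open>
  With \<open>M\<close> larger than every out-degree and \<open>D\<close> at least every distance to the sink,
  \<open>M ^ D - M ^ (D - dist v)\<close> is strictly superharmonic: the term of an out-neighbour one step
  closer to the sink dominates all the others.
\<close>

lemma superharmonic:
  obtains h where "h \<in> tests" "\<And>v. h v \<ge> 0" "\<And>v. v \<in> N \<Longrightarrow> drift h v < 0"
proof -
  define dist where "dist v = (LEAST n. (v, s) \<in> arcs_ends G ^^ n)" for v
  have dist: "(v, s) \<in> arcs_ends G ^^ dist v" if "v \<in> verts G" for v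
  proof -
    have "reachable G v s"
      using that sink by (cases "v = s") (auto simp: global_sink_def)
    then have "(v, s) \<in> (arcs_ends G)\<^sup>*"
      by (simp add: reachable_def rtrancl_on_rtranclI)
    then obtain n where "(v, s) \<in> arcs_ends G ^^ n"
      using rtrancl_imp_relpow by blast
    then show ?thesis
      unfolding dist_def by (rule LeastI)
  qed
  have dist_le: "dist v \<le> n" if "(v, s) \<in> arcs_ends G ^^ n" for v n
    unfolding dist_def using that by (rule Least_le)
  have dist_s: "dist s = 0"
    using dist_le[of s 0] by simp
  define D where "D = (\<Sum>v\<in>verts G. dist v)"
  have D: "dist v \<le> D" if "v \<in> verts G" for v
    unfolding D_def using that by (intro member_le_sum) auto
  define M :: int where "M = int (card (arcs G)) + 1"
  define h where "h v = (if v \<in> N then M ^ D - M ^ (D - dist v) else 0)" for v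
  have M1: "M \<ge> 1"
    by (simp add: M_def)
  \<comment> \<open>The closed form also holds at the sink, whose distance is \<open>0\<close>, so
    heads of edges need no case distinction.\<close>
  have h_eq: "h v = M ^ D - M ^ (D - dist v)" if "v \<in> verts G" for v
    using that dist_s by (auto simp: h_def N_eq)
  show ?thesis
  proof
    show "h \<in> tests"
      by (simp add: tests_def h_def)
    show "h v \<ge> 0" for v
      using M1 by (auto simp: h_def intro!: power_increasing)
  next
    fix v assume v: "v \<in> N"
    then have vv: "v \<in> verts G" "v \<noteq> s"
      by (auto simp: N_eq)
    have "dist v \<noteq> 0"
      using dist[OF vv(1)] vv(2) by (metis relpow_0_E)
    then obtain k where k: "dist v = Suc k"
      using not0_implies_Suc by blast
    then obtain w where "(v, w) \<in> arcs_ends G" "(w, s) \<in> arcs_ends G ^^ k"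
      using dist[OF vv(1)] by (metis relpow_Suc_D2)
    then obtain e where e: "e \<in> out_arcs G v" "dist (head G e) \<le> k"
      using dist_le by (auto simp: arcs_ends_def arc_to_ends_def)
    have heads: "head G e' \<in> verts G" if "e' \<in> out_arcs G v" for e'
      using that by auto
    have kD: "Suc k \<le> D"
      using D[OF vv(1)] k by simp
    have "drift h v = (\<Sum>e'\<in>out_arcs G v. M ^ (D - Suc k) - M ^ (D - dist (head G e')))"
      unfolding drift_def using heads vv(1) k by (intro sum.cong) (auto simp: h_eq)
    also have "\<dots> = int (deg v) * M ^ (D - Suc k) - (\<Sum>e'\<in>out_arcs G v. M ^ (D - dist (head G e')))"
      by (simp add: sum_subtractf out_degree_def)
    also have "(\<Sum>e'\<in>out_arcs G v. M ^ (D - dist (head G e'))) \<ge> M ^ (D - dist (head G e))"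
      using M1 e(1) by (intro member_le_sum) auto
    then have "int (deg v) * M ^ (D - Suc k) - (\<Sum>e'\<in>out_arcs G v. M ^ (D - dist (head G e')))
        \<le> int (deg v) * M ^ (D - Suc k) - M ^ (D - dist (head G e))"
      by simp
    also have "\<dots> \<le> int (deg v) * M ^ (D - Suc k) - M ^ (D - k)"
      using M1 e(2) by (simp add: power_increasing)
    also have "M ^ (D - k) = M * M ^ (D - Suc k)"
      using kD by (metis Suc_diff_Suc Suc_le_lessD power_Suc)
    also have "int (deg v) * M ^ (D - Suc k) - M * M ^ (D - Suc k) = (int (deg v) - M) * M ^ (D - Suc k)"
      by (simp add: algebra_simps)
    also have "\<dots> < 0"
    proof -
      have "deg v \<le> card (arcs G)"
        unfolding out_degree_def by (intro card_mono) auto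
      then show ?thesis
        using M1 by (intro mult_neg_pos) (auto simp: M_def)
    qed
    finally show "drift h v < 0" .
  qed
qed

text \<open>Each firing lowers \<open>weight h\<close>, a non-negative integer, for a superharmonic
  \<open>h\<close>. The number of chips would not do as a measure: it drops only when a vertex with
  an edge to the sink fires.\<close>

lemma ex_stabilization:
  assumes "\<sigma> \<in> chip_configs G"
  shows "\<exists>\<tau>. firing\<^sup>*\<^sup>* \<sigma> \<tau> \<and> stable G \<tau>"
proof -
  obtain h where h: "h \<in> tests" "\<And>v. h v \<ge> 0" "\<And>v. v \<in> N \<Longrightarrow> drift h v < 0"
    using superharmonic by blast
  have nn: "weight h \<sigma> \<ge> 0" for \<sigma>
    unfolding weight_def using h(2) by (intro sum_nonneg) auto
  show ?thesis
    using assms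
  proof (induction "nat (weight h \<sigma>)" arbitrary: \<sigma> rule: less_induct)
    case less
    show ?case
    proof (cases "stable G \<sigma>")
      case False
      then obtain v where v: "active G \<sigma> v"
        by (auto simp: stable_def)
      then have f: "firing \<sigma> (fire G v \<sigma>)"
        using firing_fire less.prems by blast
      then obtain \<kappa> u where "u \<in> N" "\<sigma> = \<kappa> + chips (deg u) u" "fire G v \<sigma> = \<kappa> + spread u"
        by (auto simp: firing_def)
      then have "weight h (fire G v \<sigma>) < weight h \<sigma>"
        using weight_firing[OF h(1), of \<kappa> u] h(3) by simp
      then have "nat (weight h (fire G v \<sigma>)) < nat (weight h \<sigma>)"
        using nn[of "fire G v \<sigma>"] by linarith
      from less.hyps[OF this firing_in(2)[OF f]] show ?thesis
        using f by (meson converse_rtranclp_into_rtranclp)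
    qed blast
  qed
qed

subsection \<open>Recurrent configurations\<close>

lemma chip_configs_induct [consumes 1, case_names zero add]:
  assumes "\<sigma> \<in> chip_configs G" "P 0"
    and "\<And>\<kappa> v. \<kappa> \<in> chip_configs G \<Longrightarrow> v \<in> N \<Longrightarrow> P \<kappa> \<Longrightarrow> P (\<kappa> + chips 1 v)"
  shows "P \<sigma>"
  using assms(1)
proof (induction "sum \<sigma> N" arbitrary: \<sigma>)
  case 0
  then have "\<sigma> = 0"
    by (auto simp: chip_configs_def fun_eq_iff)
  then show ?case
    using assms(2) by metis
next
  case (Suc n)
  then obtain v where v: "v \<in> N" "\<sigma> v \<noteq> 0"
    by (metis nat.distinct(1) sum.neutral)
  then obtain \<kappa> where \<kappa>: "\<kappa> \<in> chip_configs G" "\<sigma> = \<kappa> + chips 1 v"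
    using ex_add_chips[of \<sigma> v 1] Suc.prems by auto
  have "sum (chips 1 v) N = (\<Sum>w\<in>N. if w = v then 1 else 0)"
    using v by (intro sum.cong) (auto simp: chips_def)
  then have "sum \<sigma> N = sum \<kappa> N + 1"
    using v unfolding \<kappa>(2) by (simp add: sum.distrib)
  then show ?case
    using Suc.hyps \<kappa> assms(3) v(1) by simp
qed

lemma chip_moves_add:
  assumes "\<alpha> \<in> chip_configs G"
  shows "(chip_move G)\<^sup>*\<^sup>* \<tau> (\<tau> + \<alpha>)"
  using assms
proof (induction rule: chip_configs_induct)
  case (add \<kappa> v)
  have "(\<tau> + \<kappa>)(v := (\<tau> + \<kappa>) v + 1) = \<tau> + (\<kappa> + chips 1 v)"
    using add.hyps by (auto simp: chips_def fun_eq_iff)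
  then have "chip_move G (\<tau> + \<kappa>) (\<tau> + (\<kappa> + chips 1 v))"
    using chip_move.add_chip[OF add.hyps(2), of "\<tau> + \<kappa>"] by metis
  then show ?case
    using add.IH by (rule rtranclp.rtrancl_into_rtrancl[rotated])
qed (metis add.right_neutral rtranclp.rtrancl_refl)

text \<open>Adding chips keeps active vertices active, so all additions can be made first.\<close>

lemma chip_moves_imp_firings:
  assumes "(chip_move G)\<^sup>*\<^sup>* \<tau> \<sigma>" "\<tau> \<in> chip_configs G"
  shows "\<exists>\<alpha>\<in>chip_configs G. firing\<^sup>*\<^sup>* (\<tau> + \<alpha>) \<sigma>"
  using assms(1)
proof (induction rule: rtranclp_induct)
  case base
  then show ?case
    by (metis add.right_neutral rtranclp.rtrancl_refl zero_in)
next
  case (step y z)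
  then obtain \<alpha> where \<alpha>: "\<alpha> \<in> chip_configs G" "firing\<^sup>*\<^sup>* (\<tau> + \<alpha>) y"
    by blast
  have y: "y \<in> chip_configs G"
    using firings_in[OF \<alpha>(2)] \<alpha>(1) assms(2) by simp
  from step.hyps(2) show ?case
  proof cases
    case (add_chip v)
    have "y(v := y v + 1) = y + chips 1 v"
      using add_chip by (auto simp: chips_def fun_eq_iff)
    then have "firing\<^sup>*\<^sup>* (\<tau> + (\<alpha> + chips 1 v)) z"
      using firings_add[OF \<alpha>(2), of "chips 1 v"] add_chip by (simp only: chips_in ac_simps)
    then show ?thesis
      using \<alpha>(1) by (meson add_in chips_in)
  next
    case (fire_active v)
    then show ?thesis
      using \<alpha> y firing_fire by (metis rtranclp.rtrancl_into_rtrancl)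
  qed
qed

lemma firings_imp_chip_moves: "firing\<^sup>*\<^sup>* \<sigma> \<tau> \<Longrightarrow> (chip_move G)\<^sup>*\<^sup>* \<sigma> \<tau>"
  by (induction rule: rtranclp_induct)
    (auto dest: firing_imp_chip_move intro: rtranclp.rtrancl_into_rtrancl)

lemma stable_less_deg: "stable G \<sigma> \<Longrightarrow> v \<in> N \<Longrightarrow> \<sigma> v < deg v"
  by (auto simp: stable_def active_def not_le)

text \<open>Once stabilised, any configuration has fewer chips at each vertex than the out-degree,
  hence at most as many as \<sigma>. Adding the missing chips gives \<sigma>, which fires to
  \<tau>.\<close>

lemma accessible_of_firings:
  assumes "\<sigma> \<in> chip_configs G" "\<And>v. v \<in> N \<Longrightarrow> deg v \<le> \<sigma> v" "firing\<^sup>*\<^sup>* \<sigma> \<tau>"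
  shows "accessible G \<tau>"
  unfolding accessible_def
proof
  fix \<upsilon> assume \<upsilon>: "\<upsilon> \<in> chip_configs G"
  then obtain \<upsilon>' where \<upsilon>': "firing\<^sup>*\<^sup>* \<upsilon> \<upsilon>'" "stable G \<upsilon>'"
    using ex_stabilization by blast
  have in': "\<upsilon>' \<in> chip_configs G"
    using firings_in \<upsilon> \<upsilon>' by blast
  have "\<upsilon>' v \<le> \<sigma> v" if "v \<in> N" for v
    using stable_less_deg[OF \<upsilon>'(2) that] assms(2)[OF that] by simp
  then obtain \<kappa> where \<kappa>: "\<kappa> \<in> chip_configs G" "\<sigma> = \<kappa> + \<upsilon>'"
    using le_chip_configs_ex_add[OF assms(1) _ in'] by blast
  have "(chip_move G)\<^sup>*\<^sup>* \<upsilon>' \<sigma>"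
    using chip_moves_add[OF \<kappa>(1), of \<upsilon>'] \<kappa>(2) by (simp only: add.commute)
  then show "(chip_move G)\<^sup>*\<^sup>* \<upsilon> \<tau>"
    using firings_imp_chip_moves \<upsilon>'(1) assms(3) by (metis rtranclp_trans)
qed

lemma ex_recurrent_stabilization:
  assumes "\<sigma> \<in> chip_configs G" "\<And>v. v \<in> N \<Longrightarrow> deg v \<le> \<sigma> v"
  shows "\<exists>\<tau>\<in>recurrent_configs G. firing\<^sup>*\<^sup>* \<sigma> \<tau>"
  using ex_stabilization[OF assms(1)] accessible_of_firings[OF assms] firings_in assms(1)
  unfolding recurrent_configs_def by blast

section \<open>Congruence modulo the Laplacian lattice and uniqueness of recurrent
  representatives\<close>

text \<open>Equality of classes in the sandpile group, stated coordinatewise and with unrestricted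
  coefficients; this keeps extensional functions out of the argument until
  \<open>sandpile_class_eq_one_iff\<close>.\<close>

definition lattice_equiv :: "('a \<Rightarrow> nat) \<Rightarrow> ('a \<Rightarrow> nat) \<Rightarrow> bool" where
  "lattice_equiv \<sigma> \<tau> \<longleftrightarrow>
     (\<exists>c. \<forall>w\<in>N. int (\<sigma> w) - int (\<tau> w) = (\<Sum>v\<in>N. c v * reduced_laplacian G v w))"

lemma firing_apply:
  assumes "v \<in> N" "w \<in> N"
  shows "int ((\<kappa> + spread v) w) = int ((\<kappa> + chips (deg v) v) w) - reduced_laplacian G v w"
  using assms by (auto simp: spread_apply chips_def reduced_laplacian_def)

text \<open>\<open>u\<close> is a firing script: \<open>u v\<close> is how often \<open>v\<close>
  fires. If each vertex holds the chips for all its firings from the start, no order of execution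
  gets stuck, since chips received only help.\<close>

lemma firings_script:
  assumes "u \<in> chip_configs G" "\<sigma> \<in> chip_configs G" "\<And>v. v \<in> N \<Longrightarrow> u v * deg v \<le> \<sigma> v"
  shows "\<exists>\<tau>. firing\<^sup>*\<^sup>* \<sigma> \<tau> \<and>
    (\<forall>w\<in>N. int (\<tau> w) = int (\<sigma> w) - (\<Sum>v\<in>N. int (u v) * reduced_laplacian G v w))"
  using assms
proof (induction u arbitrary: \<sigma> rule: chip_configs_induct)
  case zero
  then show ?case
    by (intro exI[of _ \<sigma>]) simp
next
  case (add \<kappa> v)
  have "deg v \<le> \<sigma> v"
    using add.prems(2)[OF add.hyps(2)] add.hyps(2) by (simp add: chips_def)
  then obtain \<mu> where \<mu>: "\<mu> \<in> chip_configs G" "\<sigma> = \<mu> + chips (deg v) v"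
    using ex_add_chips add by blast
  have "\<kappa> w * deg w \<le> (\<mu> + spread v) w" if "w \<in> N" for w
    using add.prems(2)[OF that] add.hyps(2) \<mu>(2) by (simp add: chips_def split: if_splits)
  then obtain \<tau> where \<tau>: "firing\<^sup>*\<^sup>* (\<mu> + spread v) \<tau>"
    "\<And>w. w \<in> N \<Longrightarrow> int (\<tau> w) = int ((\<mu> + spread v) w) - (\<Sum>v\<in>N. int (\<kappa> v) * reduced_laplacian G v w)"
    using add.IH[of "\<mu> + spread v"] \<mu>(1) add_in spread_in by blast
  have "firing \<sigma> (\<mu> + spread v)"
    unfolding firing_def using \<mu> add.hyps(2) by blast
  then have "firing\<^sup>*\<^sup>* \<sigma> \<tau>"
    using \<tau>(1) by (rule converse_rtranclp_into_rtranclp)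
  moreover have "int (\<tau> w) = int (\<sigma> w)
      - (\<Sum>u\<in>N. int ((\<kappa> + chips 1 v) u) * reduced_laplacian G u w)" if w: "w \<in> N" for w
  proof -
    have "(\<Sum>u\<in>N. int (chips 1 v u) * reduced_laplacian G u w)
        = (\<Sum>u\<in>N. if u = v then reduced_laplacian G v w else 0)"
      using add.hyps(2) by (intro sum.cong) (auto simp: chips_def)
    then have "(\<Sum>u\<in>N. int ((\<kappa> + chips 1 v) u) * reduced_laplacian G u w)
        = (\<Sum>u\<in>N. int (\<kappa> u) * reduced_laplacian G u w) + reduced_laplacian G v w"
      using add.hyps(2) by (simp add: algebra_simps sum.distrib)
    then show ?thesis
      unfolding \<mu>(2) using \<tau>(2)[OF w] firing_apply[OF add.hyps(2) w, of \<mu>] by linarith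
  qed
  ultimately show ?case
    by blast
qed

text \<open>
  Adding to a recurrent configuration a pile \<open>\<epsilon> = \<delta> - \<delta>'\<close>, where \<open>\<delta>'\<close> stabilises \<open>\<delta>\<close>, and
  stabilising gives the configuration back. When \<open>\<epsilon>\<close> is large, two recurrent configurations that
  differ by a lattice vector can hence be fired to a common configuration.
\<close>

lemma recurrent_absorb:
  assumes "\<tau> \<in> recurrent_configs G" "\<delta> \<in> chip_configs G" "firing\<^sup>*\<^sup>* \<delta> \<delta>'"
    "\<epsilon> \<in> chip_configs G" "\<delta> = \<epsilon> + \<delta>'" "firing\<^sup>*\<^sup>* (\<tau> + \<epsilon>) \<upsilon>" "stable G \<upsilon>"
  shows "\<upsilon> = \<tau>"
proof -
  have "(chip_move G)\<^sup>*\<^sup>* \<delta> \<tau>" and stable: "stable G \<tau>"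
    using assms(1,2) by (auto simp: recurrent_configs_def accessible_def)
  then obtain \<alpha> where \<alpha>: "\<alpha> \<in> chip_configs G" "firing\<^sup>*\<^sup>* (\<delta> + \<alpha>) \<tau>"
    using chip_moves_imp_firings assms(2) by blast
  \<comment> \<open>The same configuration is fired in two ways. Firing
    \<open>\<delta> + \<alpha>\<close> first leaves \<open>\<tau> + \<epsilon>\<close>; firing only
    \<delta> first leaves \<open>\<delta>' + \<alpha> + \<epsilon>\<close>, which is
    \<open>\<delta> + \<alpha>\<close> again, and then \<tau>. Stabilisation is unique.\<close>
  have "firing\<^sup>*\<^sup>* (\<delta> + \<alpha> + \<epsilon>) \<upsilon>"
    using firings_add[OF \<alpha>(2) assms(4)] assms(6) by (rule rtranclp_trans)
  moreover have "firing\<^sup>*\<^sup>* (\<delta> + \<alpha> + \<epsilon>) \<tau>"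
  proof -
    have "firing\<^sup>*\<^sup>* (\<delta> + (\<alpha> + \<epsilon>)) (\<delta>' + (\<alpha> + \<epsilon>))"
      using \<alpha>(1) assms(3,4) by (intro firings_add) simp_all
    moreover have "\<delta>' + (\<alpha> + \<epsilon>) = \<delta> + \<alpha>"
      unfolding assms(5) by (simp only: ac_simps)
    ultimately show ?thesis
      using \<alpha>(2) by (metis add.assoc rtranclp_trans)
  qed
  ultimately show ?thesis
    using stabilization_unique assms(7) stable by blast
qed

lemma recurrent_unique:
  assumes "\<sigma> \<in> recurrent_configs G" "\<tau> \<in> recurrent_configs G" "lattice_equiv \<sigma> \<tau>"
  shows "\<sigma> = \<tau>"
proof -
  obtain c where c: "\<And>w. w \<in> N \<Longrightarrow> int (\<sigma> w) - int (\<tau> w) = (\<Sum>v\<in>N. c v * reduced_laplacian G v w)"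
    using assms(3) unfolding lattice_equiv_def by blast
  have \<sigma>: "\<sigma> \<in> chip_configs G" and \<tau>: "\<tau> \<in> chip_configs G"
    using assms by (auto simp: recurrent_configs_def)
  define m where "m = (\<Sum>v\<in>N. nat \<bar>c v\<bar>)"
  have m: "nat \<bar>c v\<bar> \<le> m" if "v \<in> N" for v
    unfolding m_def using that by (intro member_le_sum) auto
  \<comment> \<open>Positive and negative parts of the coefficients:
    \<open>\<sigma> + \<epsilon>\<close> fires the script \<open>p\<close>,
    \<open>\<tau> + \<epsilon>\<close> fires \<open>q\<close>, and the two meet.\<close>
  define p where "p v = (if v \<in> N then nat (c v) else 0)" for v
  define q where "q v = (if v \<in> N then nat (- c v) else 0)" for v
  have pq: "p \<in> chip_configs G" "q \<in> chip_configs G"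
    by (auto simp: p_def q_def chip_configs_def)
  have pqm: "p v \<le> m" "q v \<le> m" if "v \<in> N" for v
    using m[OF that] that by (auto simp: p_def q_def)
  \<comment> \<open>The stabilisation \<delta>' keeps fewer than \<open>deg v\<close> chips at
    \<open>v\<close>, so the factor \<open>m + 1\<close> leaves at least \<open>m * deg v\<close> of
    them to \<epsilon>, enough for both scripts.\<close>
  define \<delta> where "\<delta> v = (if v \<in> N then (m + 1) * deg v else 0)" for v
  have \<delta>: "\<delta> \<in> chip_configs G"
    by (auto simp: \<delta>_def chip_configs_def)
  then obtain \<delta>' where \<delta>': "firing\<^sup>*\<^sup>* \<delta> \<delta>'" "stable G \<delta>'"
    using ex_stabilization by blast
  have "\<delta>' v \<le> \<delta> v" if "v \<in> N" for v
    using stable_less_deg[OF \<delta>'(2) that] that by (simp add: \<delta>_def)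
  then obtain \<epsilon> where \<epsilon>: "\<epsilon> \<in> chip_configs G" "\<delta> = \<epsilon> + \<delta>'"
    using le_chip_configs_ex_add[OF \<delta>] firings_in[OF \<delta>'(1) \<delta>] by blast
  have big: "m * deg v \<le> \<epsilon> v" if "v \<in> N" for v
    using stable_less_deg[OF \<delta>'(2) that] fun_cong[OF \<epsilon>(2), of v] that by (simp add: \<delta>_def)
  have pq_le: "p v * deg v \<le> (\<sigma> + \<epsilon>) v" "q v * deg v \<le> (\<tau> + \<epsilon>) v" if "v \<in> N" for v
  proof -
    have "p v * deg v \<le> \<epsilon> v" "q v * deg v \<le> \<epsilon> v"
      using big[OF that] pqm[OF that] by (meson mult_right_mono order_trans zero_le)+
    then show "p v * deg v \<le> (\<sigma> + \<epsilon>) v" "q v * deg v \<le> (\<tau> + \<epsilon>) v"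
      by simp_all
  qed
  obtain \<mu> where \<mu>: "firing\<^sup>*\<^sup>* (\<sigma> + \<epsilon>) \<mu>"
    "\<And>w. w \<in> N \<Longrightarrow> int (\<mu> w) = int ((\<sigma> + \<epsilon>) w) - (\<Sum>v\<in>N. int (p v) * reduced_laplacian G v w)"
    using firings_script[OF pq(1) add_in[OF \<sigma> \<epsilon>(1)] pq_le(1)] by blast
  obtain \<mu>' where \<mu>': "firing\<^sup>*\<^sup>* (\<tau> + \<epsilon>) \<mu>'"
    "\<And>w. w \<in> N \<Longrightarrow> int (\<mu>' w) = int ((\<tau> + \<epsilon>) w) - (\<Sum>v\<in>N. int (q v) * reduced_laplacian G v w)"
    using firings_script[OF pq(2) add_in[OF \<tau> \<epsilon>(1)] pq_le(2)] by blast
  have in\<mu>: "\<mu> \<in> chip_configs G" "\<mu>' \<in> chip_configs G"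
    using firings_in \<mu>(1) \<mu>'(1) \<sigma> \<tau> \<epsilon>(1) add_in by blast+
  have "\<mu> w = \<mu>' w" for w
  proof (cases "w \<in> N")
    case w: True
    have "(\<Sum>v\<in>N. c v * reduced_laplacian G v w)
        = (\<Sum>v\<in>N. int (p v) * reduced_laplacian G v w - int (q v) * reduced_laplacian G v w)"
      by (intro sum.cong) (auto simp: p_def q_def algebra_simps)
    then have "int (\<mu> w) = int (\<mu>' w)"
      using \<mu>(2)[OF w] \<mu>'(2)[OF w] c[OF w] by (simp add: sum_subtractf)
    then show ?thesis by simp
  qed (use in\<mu> in \<open>simp add: chip_configs_def\<close>)
  then have eq: "\<mu> = \<mu>'" ..
  obtain \<nu> where \<nu>: "firing\<^sup>*\<^sup>* \<mu> \<nu>" "stable G \<nu>"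
    using ex_stabilization in\<mu> by blast
  have "\<nu> = \<sigma>"
    using recurrent_absorb[OF assms(1) \<delta> \<delta>'(1) \<epsilon>] \<mu>(1) \<nu> by (meson rtranclp_trans)
  moreover have "\<nu> = \<tau>"
    using recurrent_absorb[OF assms(2) \<delta> \<delta>'(1) \<epsilon>] \<mu>'(1) \<nu> eq by (meson rtranclp_trans)
  ultimately show ?thesis by simp
qed

section \<open>Lattice vectors from weights, and the classes of the sandpile group\<close>

lemma weight_indicator: "w \<in> N \<Longrightarrow> weight (\<lambda>x. if x = w then 1 else 0) \<sigma> = int (\<sigma> w)"
  by (simp add: weight_def if_distrib cong: if_cong)

text \<open>The drift at \<open>v\<close> of the indicator of \<open>w\<close> is
  \<open>- reduced_laplacian G v w\<close>, so the coefficients of the lattice vector are the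
  negated \<open>c\<close>.\<close>

lemma lattice_equivI:
  assumes "\<And>\<phi>. \<phi> \<in> tests \<Longrightarrow> weight \<phi> \<sigma> - weight \<phi> \<tau> = (\<Sum>v\<in>N. c v * drift \<phi> v)"
  shows "lattice_equiv \<sigma> \<tau>"
  unfolding lattice_equiv_def
proof (intro exI ballI)
  fix w assume w: "w \<in> N"
  let ?\<phi> = "\<lambda>x. if x = w then 1 else 0 :: int"
  have \<phi>: "?\<phi> \<in> tests"
    using w by (auto simp: tests_def)
  have d: "drift ?\<phi> v = - reduced_laplacian G v w" if "v \<in> N" for v
    using weight_firing[OF \<phi>, of 0 v] firing_apply[OF that w, of 0] unfolding weight_indicator[OF w]
    by linarith
  have "int (\<sigma> w) - int (\<tau> w) = (\<Sum>v\<in>N. c v * drift ?\<phi> v)"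
    using assms[OF \<phi>] by (simp add: weight_indicator[OF w])
  also have "\<dots> = (\<Sum>v\<in>N. (- c v) * reduced_laplacian G v w)"
    by (rule sum.cong) (simp_all add: d)
  finally show "int (\<sigma> w) - int (\<tau> w) = (\<Sum>v\<in>N. (- c v) * reduced_laplacian G v w)" .
qed

lemma lattice_equiv_sym:
  assumes "lattice_equiv \<sigma> \<tau>"
  shows "lattice_equiv \<tau> \<sigma>"
proof -
  obtain c where "\<forall>w\<in>N. int (\<sigma> w) - int (\<tau> w) = (\<Sum>v\<in>N. c v * reduced_laplacian G v w)"
    using assms lattice_equiv_def by blast
  then have "\<forall>w\<in>N. int (\<tau> w) - int (\<sigma> w) = (\<Sum>v\<in>N. (- c v) * reduced_laplacian G v w)"
    by (simp add: sum_negf) (smt (verit))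
  then show ?thesis
    unfolding lattice_equiv_def by (intro exI[of _ "\<lambda>v. - c v"])
qed

lemma lattice_equiv_trans:
  assumes "lattice_equiv \<sigma> \<tau>" "lattice_equiv \<tau> \<upsilon>"
  shows "lattice_equiv \<sigma> \<upsilon>"
proof -
  obtain c d where "\<forall>w\<in>N. int (\<sigma> w) - int (\<tau> w) = (\<Sum>v\<in>N. c v * reduced_laplacian G v w)"
    "\<forall>w\<in>N. int (\<tau> w) - int (\<upsilon> w) = (\<Sum>v\<in>N. d v * reduced_laplacian G v w)"
    using assms lattice_equiv_def by blast
  then have "\<forall>w\<in>N. int (\<sigma> w) - int (\<upsilon> w) = (\<Sum>v\<in>N. (c v + d v) * reduced_laplacian G v w)"
    by (simp add: distrib_right sum.distrib) (smt (verit))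
  then show ?thesis
    unfolding lattice_equiv_def by (intro exI[of _ "\<lambda>v. c v + d v"])
qed

text \<open>The identity of the quotient is the lattice itself, and a coset equals the lattice
  exactly when it contains a representative lying there. Translating the coefficients by
  \<open>c\<close> is a bijection, which gives the equality of the two ranges.\<close>

lemma sandpile_class_eq_one_iff:
  "sandpile_class G \<sigma> = \<one>\<^bsub>sandpile_group G\<^esub> \<longleftrightarrow> lattice_equiv \<sigma> 0"
proof -
  define L where "L x = (\<lambda>w\<in>N. \<Sum>v\<in>N. x v * reduced_laplacian G v w)" for x
  have lat: "laplacian_lattice G = range L"
  proof -
    have "L x = L (restrict x N)" for x
      by (auto simp: L_def fun_eq_iff intro!: sum.cong)
    then have "range L \<subseteq> L ` (\<Pi>\<^sub>E v\<in>N. UNIV)"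
      by (metis (no_types, lifting) image_eqI image_subsetI restrict_PiE_iff UNIV_I)
    then show ?thesis
      by (auto simp: laplacian_lattice_def L_def[abs_def])
  qed
  have one: "\<one>\<^bsub>sandpile_group G\<^esub> = range L"
    by (simp add: sandpile_group_def FactGroup_def lat)
  have coset: "sandpile_class G \<sigma> = (\<lambda>x. \<lambda>w\<in>N. L x w + int (\<sigma> w)) ` UNIV"
  proof -
    have "h \<otimes>\<^bsub>int_vectors G\<^esub> (\<lambda>v\<in>N. int (\<sigma> v)) = (\<lambda>w\<in>N. h w + int (\<sigma> w))" for h
      by (simp cong: restrict_cong)
    then show ?thesis
      by (auto simp: sandpile_class_def r_coset_def lat)
  qed
  show ?thesis
    unfolding one coset
  proof
    assume eq: "range (\<lambda>x. \<lambda>w\<in>N. L x w + int (\<sigma> w)) = range L"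
    have "(\<lambda>w\<in>N. L (\<lambda>_. 0) w + int (\<sigma> w)) \<in> range L"
      using eq by blast
    then obtain x where x: "(\<lambda>w\<in>N. L (\<lambda>_. 0) w + int (\<sigma> w)) = L x"
      by blast
    have "int (\<sigma> w) = (\<Sum>v\<in>N. x v * reduced_laplacian G v w)" if "w \<in> N" for w
      using fun_cong[OF x, of w] that by (simp add: L_def)
    then show "lattice_equiv \<sigma> 0"
      by (auto simp: lattice_equiv_def)
  next
    assume "lattice_equiv \<sigma> 0"
    then obtain c where c: "\<And>w. w \<in> N \<Longrightarrow> int (\<sigma> w) = (\<Sum>v\<in>N. c v * reduced_laplacian G v w)"
      by (auto simp: lattice_equiv_def)
    have shift: "(\<lambda>w\<in>N. L x w + int (\<sigma> w)) = L (\<lambda>v. x v + c v)" for x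
      using c by (auto simp: L_def fun_eq_iff sum.distrib distrib_right)
    have "L x \<in> range (\<lambda>x. L (\<lambda>v. x v + c v))" for x
      by (rule range_eqI[of _ _ "\<lambda>v. x v - c v"]) simp
    then show "range (\<lambda>x. \<lambda>w\<in>N. L x w + int (\<sigma> w)) = range L"
      unfolding shift by auto
  qed
qed

end

section \<open>Rotor-routing\<close>

locale rotor_network = sink_digraph G s for G :: "('a,'b) pre_digraph" and s +
  fixes nxt :: "'b \<Rightarrow> 'b"
  assumes order: "rotor_order G nxt"
begin

text \<open>Any non-empty pile at a non-sink vertex may supply the next chip, so all orders of
  routing several chips are covered. A chip that moves to the sink disappears because
  \<open>chips 1 s = 0\<close>; a completed routing ends with the pile \<open>0\<close>.\<close>

definition routing :: "('a \<Rightarrow> nat) \<times> ('a \<Rightarrow> 'b) \<Rightarrow> ('a \<Rightarrow> nat) \<times> ('a \<Rightarrow> 'b) \<Rightarrow> bool" where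
  "routing x y \<longleftrightarrow> (\<exists>\<sigma>\<in>chip_configs G. \<exists>v\<in>N. \<exists>\<rho>\<in>rotor_configs G. x = (\<sigma> + chips 1 v, \<rho>) \<and>
     y = (\<sigma> + chips 1 (head G (nxt (\<rho> v))), \<rho>(v := nxt (\<rho> v))))"

lemma routingI:
  "\<sigma> \<in> chip_configs G \<Longrightarrow> v \<in> N \<Longrightarrow> \<rho> \<in> rotor_configs G \<Longrightarrow>
   routing (\<sigma> + chips 1 v, \<rho>) (\<sigma> + chips 1 (head G (nxt (\<rho> v))), \<rho>(v := nxt (\<rho> v)))"
  unfolding routing_def by blast

lemma cyclic: "v \<in> N \<Longrightarrow> cyclic_on nxt (out_arcs G v)"
  using order by (simp add: rotor_order_def)

lemma rotor_arc: "\<rho> \<in> rotor_configs G \<Longrightarrow> v \<in> N \<Longrightarrow> \<rho> v \<in> out_arcs G v"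
  unfolding rotor_configs_def by (rule PiE_mem)

lemma nxt_arc: "\<rho> \<in> rotor_configs G \<Longrightarrow> v \<in> N \<Longrightarrow> nxt (\<rho> v) \<in> out_arcs G v"
  using cyclic_on_inI[OF cyclic rotor_arc] by blast

lemma rotor_upd:
  "\<rho> \<in> rotor_configs G \<Longrightarrow> v \<in> N \<Longrightarrow> e \<in> out_arcs G v \<Longrightarrow> \<rho>(v := e) \<in> rotor_configs G"
  unfolding rotor_configs_def by (metis fun_upd_triv fun_upd_in_PiE insert_absorb PiE_fun_upd)

lemma rotor_upd_nxt:
  "\<rho> \<in> rotor_configs G \<Longrightarrow> v \<in> N \<Longrightarrow> \<rho>(v := nxt (\<rho> v)) \<in> rotor_configs G"
  by (simp add: rotor_upd nxt_arc del: in_out_arcs_conv)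

lemma head_nxt_in_verts:
  "\<rho> \<in> rotor_configs G \<Longrightarrow> v \<in> N \<Longrightarrow> head G (nxt (\<rho> v)) \<in> verts G"
  using nxt_arc by fastforce

lemma finite_rotor_configs: "finite (rotor_configs G)"
  unfolding rotor_configs_def by (intro finite_PiE) (auto simp: finite_out_arcs simp del: in_out_arcs_conv)

lemma routing_in:
  assumes "routing (\<sigma>, \<rho>) (\<tau>, \<rho>')"
  shows "\<tau> \<in> chip_configs G" "\<rho>' \<in> rotor_configs G"
  using assms rotor_upd_nxt by (auto simp: routing_def)

lemma routings_in:
  assumes "routing\<^sup>*\<^sup>* (\<sigma>, \<rho>) (\<tau>, \<rho>')" "\<sigma> \<in> chip_configs G" "\<rho> \<in> rotor_configs G"
  shows "\<tau> \<in> chip_configs G \<and> \<rho>' \<in> rotor_configs G"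
  using assms by (induction "(\<tau>, \<rho>')" arbitrary: \<tau> \<rho>' rule: rtranclp_induct) (use routing_in in auto)

lemma routing_add:
  assumes "routing (\<sigma>, \<rho>) (\<tau>, \<rho>')" "\<kappa> \<in> chip_configs G"
  shows "routing (\<sigma> + \<kappa>, \<rho>) (\<tau> + \<kappa>, \<rho>')"
proof -
  obtain \<mu> v where *: "\<mu> \<in> chip_configs G" "v \<in> N" "\<rho> \<in> rotor_configs G" "\<sigma> = \<mu> + chips 1 v"
    "\<tau> = \<mu> + chips 1 (head G (nxt (\<rho> v)))" "\<rho>' = \<rho>(v := nxt (\<rho> v))"
    using assms(1) unfolding routing_def by blast
  show ?thesis
    using routingI[of "\<mu> + \<kappa>" v \<rho>] * assms(2) by (simp only: add_in ac_simps)
qed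

lemma routings_add:
  assumes "routing\<^sup>*\<^sup>* (\<sigma>, \<rho>) (\<tau>, \<rho>')" "\<kappa> \<in> chip_configs G"
  shows "routing\<^sup>*\<^sup>* (\<sigma> + \<kappa>, \<rho>) (\<tau> + \<kappa>, \<rho>')"
  using assms(1)
proof (induction "(\<tau>, \<rho>')" arbitrary: \<tau> \<rho>' rule: rtranclp_induct)
  case (step y)
  then show ?case
    using routing_add[OF _ assms(2)] by (metis rtranclp.rtrancl_into_rtrancl surj_pair)
qed simp

section \<open>Confluence of rotor-routing\<close>

text \<open>Chips are indistinguishable, so a step is determined by the vertex where it happens.
  Steps at different vertices use different chips and different rotors, and commute.\<close>

lemma confluentp_routing: "confluentp routing"
proof (rule strong_confluentp_imp_confluentp, rule strong_confluentpI)
  fix x y z assume "routing x y" "routing x z"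
  then obtain \<sigma> v \<rho> \<tau> w where *: "\<sigma> \<in> chip_configs G" "v \<in> N" "\<rho> \<in> rotor_configs G"
    "x = (\<sigma> + chips 1 v, \<rho>)" "y = (\<sigma> + chips 1 (head G (nxt (\<rho> v))), \<rho>(v := nxt (\<rho> v)))"
    "\<tau> \<in> chip_configs G" "w \<in> N"
    "\<sigma> + chips 1 v = \<tau> + chips 1 w" "z = (\<tau> + chips 1 (head G (nxt (\<rho> w))), \<rho>(w := nxt (\<rho> w)))"
    unfolding routing_def by auto
  show "\<exists>u. routing\<^sup>*\<^sup>* y u \<and> routing\<^sup>=\<^sup>= z u"
  proof (cases "v = w")
    case True
    then have "y = z"
      using * by (metis add_right_cancel)
    then show ?thesis by blast
  next
    case False
    have "1 \<le> \<sigma> w"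
      using fun_cong[OF *(8), of w] False *(7) by (simp add: chips_def)
    then obtain \<kappa> where \<kappa>: "\<kappa> \<in> chip_configs G" "\<sigma> = \<kappa> + chips 1 w"
      using ex_add_chips * by blast
    then have "\<tau> + chips 1 w = (\<kappa> + chips 1 v) + chips 1 w"
      using *(8) by (simp add: ac_simps)
    then have \<tau>: "\<tau> = \<kappa> + chips 1 v"
      by (metis add_right_cancel)
    let ?u = "(\<kappa> + chips 1 (head G (nxt (\<rho> v))) + chips 1 (head G (nxt (\<rho> w))),
      \<rho>(v := nxt (\<rho> v), w := nxt (\<rho> w)))"
    have "routing y ?u"
      using routingI[of "\<kappa> + chips 1 (head G (nxt (\<rho> v)))" w "\<rho>(v := nxt (\<rho> v))"] *(2,3,5,7) \<kappa> False
      by (simp add: rotor_upd_nxt ac_simps)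
    moreover have "routing z ?u"
      using routingI[of "\<kappa> + chips 1 (head G (nxt (\<rho> w)))" v "\<rho>(w := nxt (\<rho> w))"] *(2,3,7,9) \<kappa>(1) \<tau> False
      by (simp add: rotor_upd_nxt ac_simps fun_upd_twist)
    ultimately show ?thesis by blast
  qed
qed

lemma not_routing_zero: "\<not> routing (0, \<rho>) y"
proof
  assume "routing (0, \<rho>) y"
  then obtain \<sigma> v where *: "v \<in> N" "0 = \<sigma> + chips 1 v"
    unfolding routing_def by auto
  show False
    using fun_cong[OF *(2), of v] *(1) by (simp add: chips_def)
qed

lemma routings_unique:
  assumes "routing\<^sup>*\<^sup>* x (0, \<rho>)" "routing\<^sup>*\<^sup>* x (0, \<rho>')"
  shows "\<rho> = \<rho>'"
  using confluentpD[OF confluentp_routing assms] not_routing_zero by (metis converse_rtranclpE prod.inject)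

lemma routings_at:
  assumes "\<kappa> \<in> chip_configs G" "v \<in> N" "\<rho> \<in> rotor_configs G"
  shows "routing\<^sup>*\<^sup>* (\<kappa> + chips k v, \<rho>)
    (\<kappa> + (\<Sum>j<k. chips 1 (head G ((nxt ^^ Suc j) (\<rho> v)))), \<rho>(v := (nxt ^^ k) (\<rho> v)))"
proof (induction k)
  case (Suc k)
  let ?\<tau> = "\<Sum>j<k. chips 1 (head G ((nxt ^^ Suc j) (\<rho> v)))" and ?\<rho> = "\<rho>(v := (nxt ^^ k) (\<rho> v))"
  have in': "?\<tau> \<in> chip_configs G"
    by (rule sum_in) simp
  have \<rho>: "?\<rho> \<in> rotor_configs G"
    using rotor_upd cyclic_on_funpow_in[OF cyclic rotor_arc] assms by blast
  have "routing\<^sup>*\<^sup>* (\<kappa> + chips (Suc k) v, \<rho>) (\<kappa> + ?\<tau> + chips 1 v, ?\<rho>)"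
  proof -
    have "\<kappa> + chips k v + chips 1 v = \<kappa> + chips (Suc k) v"
      by (simp only: add.assoc chips_add Suc_eq_plus1)
    then show ?thesis
      using routings_add[OF Suc chips_in[of 1 v]] by (simp only:)
  qed
  moreover have "routing (\<kappa> + ?\<tau> + chips 1 v, ?\<rho>)
      (\<kappa> + ?\<tau> + chips 1 (head G (nxt (?\<rho> v))), ?\<rho>(v := nxt (?\<rho> v)))"
    using routingI[of "\<kappa> + ?\<tau>" v ?\<rho>] assms(1,2) in' \<rho> by (metis add_in)
  ultimately have "routing\<^sup>*\<^sup>* (\<kappa> + chips (Suc k) v, \<rho>)
      (\<kappa> + ?\<tau> + chips 1 (head G (nxt (?\<rho> v))), ?\<rho>(v := nxt (?\<rho> v)))"
    by (rule rtranclp.rtrancl_into_rtrancl)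
  then show ?case
    by (simp add: add.assoc fun_upd_same del: plus_fun_apply fun_upd_apply)
qed simp

text \<open>When \<open>v\<close> fires, its rotor makes one full turn.\<close>

lemma firing_imp_routings:
  assumes "firing \<sigma> \<tau>" "\<rho> \<in> rotor_configs G"
  shows "routing\<^sup>*\<^sup>* (\<sigma>, \<rho>) (\<tau>, \<rho>)"
proof -
  obtain \<kappa> v where *: "\<kappa> \<in> chip_configs G" "v \<in> N" "\<sigma> = \<kappa> + chips (deg v) v" "\<tau> = \<kappa> + spread v"
    using assms(1) by (auto simp: firing_def)
  note b = bij_betw_funpow_cyclic_on[OF cyclic[OF *(2)] rotor_arc[OF assms(2) *(2)], folded out_degree_def]
  have "(\<Sum>j<deg v. chips 1 (head G ((nxt ^^ Suc j) (\<rho> v)))) = spread v"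
    unfolding spread_def using b(2) by (rule sum.reindex_bij_betw)
  then show ?thesis
    using routings_at[OF *(1,2) assms(2), of "deg v"] b(1) * by simp
qed

lemma firings_imp_routings:
  assumes "firing\<^sup>*\<^sup>* \<sigma> \<tau>" "\<rho> \<in> rotor_configs G"
  shows "routing\<^sup>*\<^sup>* (\<sigma>, \<rho>) (\<tau>, \<rho>)"
  using assms(1)
proof (induction rule: rtranclp_induct)
  case (step \<tau> \<upsilon>)
  then show ?case
    using firing_imp_routings[OF step.hyps(2) assms(2)] by (metis rtranclp_trans)
qed simp

subsection \<open>Odometers\<close>

text \<open>\<open>u v\<close> counts the steps taken at \<open>v\<close>.\<close>

lemma ex_odometer:
  assumes "(routing ^^ n) (\<sigma>, \<rho>) (\<tau>, \<rho>')"
  shows "\<exists>u. sum u N = n \<and> (\<forall>v\<in>N. \<rho>' v = (nxt ^^ u v) (\<rho> v)) \<and>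
    (\<forall>\<phi>\<in>tests. weight \<phi> \<tau> = weight \<phi> \<sigma> +
       (\<Sum>v\<in>N. \<Sum>j<u v. \<phi> (head G ((nxt ^^ Suc j) (\<rho> v))) - \<phi> v))"
  using assms
proof (induction n arbitrary: \<tau> \<rho>')
  case 0
  then show ?case
    by (intro exI[of _ "\<lambda>_. 0"]) auto
next
  case (Suc n)
  from Suc.prems obtain x where "(routing ^^ n) (\<sigma>, \<rho>) x" "routing x (\<tau>, \<rho>')"
    by (rule relpowp_Suc_E)
  then obtain \<tau>\<^sub>1 \<rho>\<^sub>1 where 1: "(routing ^^ n) (\<sigma>, \<rho>) (\<tau>\<^sub>1, \<rho>\<^sub>1)" "routing (\<tau>\<^sub>1, \<rho>\<^sub>1) (\<tau>, \<rho>')"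
    by (cases x) blast
  obtain u where u: "sum u N = n" "\<And>v. v \<in> N \<Longrightarrow> \<rho>\<^sub>1 v = (nxt ^^ u v) (\<rho> v)"
    "\<And>\<phi>. \<phi> \<in> tests \<Longrightarrow> weight \<phi> \<tau>\<^sub>1 = weight \<phi> \<sigma> +
       (\<Sum>v\<in>N. \<Sum>j<u v. \<phi> (head G ((nxt ^^ Suc j) (\<rho> v))) - \<phi> v)"
    using Suc.IH[OF 1(1)] by blast
  obtain \<kappa> w where w: "w \<in> N" "\<tau>\<^sub>1 = \<kappa> + chips 1 w"
    "\<tau> = \<kappa> + chips 1 (head G (nxt (\<rho>\<^sub>1 w)))" "\<rho>' = \<rho>\<^sub>1(w := nxt (\<rho>\<^sub>1 w))"
    using 1(2) unfolding routing_def by auto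
  have upd: "(\<Sum>v\<in>N. g v ((u(w := Suc (u w))) v)) = (\<Sum>v\<in>N. g v (u v)) + (g w (Suc (u w)) - g w (u w))"
    for g :: "'a \<Rightarrow> nat \<Rightarrow> int"
    using w(1) by (simp add: sum.remove[of N w])
  have "sum (u(w := Suc (u w))) N = Suc n"
    using u(1) w(1) by (simp add: sum.remove[of N w])
  moreover have "\<rho>' v = (nxt ^^ (u(w := Suc (u w))) v) (\<rho> v)" if "v \<in> N" for v
    using u(2)[OF that] u(2)[OF w(1)] w(4) by auto
  moreover have "weight \<phi> \<tau> = weight \<phi> \<sigma> +
       (\<Sum>v\<in>N. \<Sum>j<(u(w := Suc (u w))) v. \<phi> (head G ((nxt ^^ Suc j) (\<rho> v))) - \<phi> v)"
    if \<phi>: "\<phi> \<in> tests" for \<phi>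
  proof -
    have "weight \<phi> \<tau> = weight \<phi> \<tau>\<^sub>1 + (\<phi> (head G ((nxt ^^ Suc (u w)) (\<rho> w))) - \<phi> w)"
      using u(2)[OF w(1)] unfolding w(2,3) weight_add weight_chips[OF \<phi>] by simp
    then show ?thesis
      using upd[of "\<lambda>v k. \<Sum>j<k. \<phi> (head G ((nxt ^^ Suc j) (\<rho> v))) - \<phi> v"] u(3)[OF \<phi>] by simp
  qed
  ultimately show ?case
    by blast
qed

text \<open>
  If two routings from \<open>\<rho>\<close> end with the same rotors, then at each \<open>v\<close> their odometers differ by a
  number \<open>c v\<close> of full turns.
\<close>

lemma weight_eq_of_same_rotors:
  assumes "(routing ^^ m) (\<sigma>, \<rho>) (\<sigma>', \<rho>')" "(routing ^^ n) (\<tau>, \<rho>) (\<tau>', \<rho>')" "\<rho> \<in> rotor_configs G"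
  shows "\<exists>c. \<forall>\<phi>\<in>tests. (weight \<phi> \<sigma>' - weight \<phi> \<sigma>) - (weight \<phi> \<tau>' - weight \<phi> \<tau>) = (\<Sum>v\<in>N. c v * drift \<phi> v)"
proof -
  obtain a where a: "sum a N = m" "\<And>v. v \<in> N \<Longrightarrow> \<rho>' v = (nxt ^^ a v) (\<rho> v)"
    "\<And>\<phi>. \<phi> \<in> tests \<Longrightarrow> weight \<phi> \<sigma>' = weight \<phi> \<sigma> +
       (\<Sum>v\<in>N. \<Sum>j<a v. \<phi> (head G ((nxt ^^ Suc j) (\<rho> v))) - \<phi> v)"
    using ex_odometer[OF assms(1)] by blast
  obtain b where b: "sum b N = n" "\<And>v. v \<in> N \<Longrightarrow> \<rho>' v = (nxt ^^ b v) (\<rho> v)"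
    "\<And>\<phi>. \<phi> \<in> tests \<Longrightarrow> weight \<phi> \<tau>' = weight \<phi> \<tau> +
       (\<Sum>v\<in>N. \<Sum>j<b v. \<phi> (head G ((nxt ^^ Suc j) (\<rho> v))) - \<phi> v)"
    using ex_odometer[OF assms(2)] by blast
  have "\<forall>v\<in>N. \<exists>c. \<forall>g :: 'b \<Rightarrow> int. (\<Sum>j<a v. g ((nxt ^^ Suc j) (\<rho> v))) -
      (\<Sum>j<b v. g ((nxt ^^ Suc j) (\<rho> v))) = c * sum g (out_arcs G v)"
    using sum_funpow_cyclic_diff[OF cyclic rotor_arc[OF assms(3)]] a(2) b(2) by metis
  then obtain c where c: "\<And>v g :: 'b \<Rightarrow> int. v \<in> N \<Longrightarrow> (\<Sum>j<a v. g ((nxt ^^ Suc j) (\<rho> v))) -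
      (\<Sum>j<b v. g ((nxt ^^ Suc j) (\<rho> v))) = c v * sum g (out_arcs G v)"
    by metis
  have "(weight \<phi> \<sigma>' - weight \<phi> \<sigma>) - (weight \<phi> \<tau>' - weight \<phi> \<tau>) = (\<Sum>v\<in>N. c v * drift \<phi> v)"
    if \<phi>: "\<phi> \<in> tests" for \<phi>
  proof -
    have "(weight \<phi> \<sigma>' - weight \<phi> \<sigma>) - (weight \<phi> \<tau>' - weight \<phi> \<tau>) =
        (\<Sum>v\<in>N. (\<Sum>j<a v. \<phi> (head G ((nxt ^^ Suc j) (\<rho> v))) - \<phi> v) -
          (\<Sum>j<b v. \<phi> (head G ((nxt ^^ Suc j) (\<rho> v))) - \<phi> v))"
      using a(3)[OF \<phi>] b(3)[OF \<phi>] by (simp add: sum_subtractf)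
    also have "\<dots> = (\<Sum>v\<in>N. c v * drift \<phi> v)"
      unfolding drift_def by (rule sum.cong[OF refl]) (rule c)
    finally show ?thesis .
  qed
  then show ?thesis
    by blast
qed

lemma lattice_equiv_of_routings:
  assumes "routing\<^sup>*\<^sup>* (\<sigma>, \<rho>) (0, \<rho>')" "routing\<^sup>*\<^sup>* (\<tau>, \<rho>) (0, \<rho>')" "\<rho> \<in> rotor_configs G"
  shows "lattice_equiv \<sigma> \<tau>"
proof -
  obtain m n where "(routing ^^ m) (\<sigma>, \<rho>) (0, \<rho>')" "(routing ^^ n) (\<tau>, \<rho>) (0, \<rho>')"
    using assms(1,2) rtranclp_imp_relpowp by metis
  \<comment> \<open>The routing of \<tau> is passed first: with both final piles empty, the
    left-hand side then reads \<open>weight \<phi> \<sigma> - weight \<phi> \<tau>\<close>.\<close>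
  from weight_eq_of_same_rotors[OF this(2,1) assms(3)] obtain c where
    "\<And>\<phi>. \<phi> \<in> tests \<Longrightarrow> (weight \<phi> 0 - weight \<phi> \<tau>) - (weight \<phi> 0 - weight \<phi> \<sigma>) = (\<Sum>v\<in>N. c v * drift \<phi> v)"
    by blast
  then show ?thesis
    by (intro lattice_equivI[where c = c]) (simp add: weight_def)
qed

text \<open>If the rotors come back, every vertex has made whole turns, at least one of them
  somewhere. This lowers \<open>weight h\<close> for a superharmonic \<open>h\<close>, so the chips
  cannot have come back too.\<close>

lemma routing_no_return: "\<rho> \<in> rotor_configs G \<Longrightarrow> \<not> routing\<^sup>+\<^sup>+ (\<sigma>, \<rho>) (\<sigma>, \<rho>)"
proof
  assume \<rho>: "\<rho> \<in> rotor_configs G" and "routing\<^sup>+\<^sup>+ (\<sigma>, \<rho>) (\<sigma>, \<rho>)"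
  then obtain n where n: "n > 0" "(routing ^^ n) (\<sigma>, \<rho>) (\<sigma>, \<rho>)"
    by (auto simp: tranclp_power)
  obtain u where u: "sum u N = n" "\<And>v. v \<in> N \<Longrightarrow> \<rho> v = (nxt ^^ u v) (\<rho> v)"
    "\<And>\<phi>. \<phi> \<in> tests \<Longrightarrow> weight \<phi> \<sigma> = weight \<phi> \<sigma> +
       (\<Sum>v\<in>N. \<Sum>j<u v. \<phi> (head G ((nxt ^^ Suc j) (\<rho> v))) - \<phi> v)"
    using ex_odometer[OF n(2)] by blast
  have "\<exists>k. u v = k * deg v" if "v \<in> N" for v
    using funpow_cyclic_eqD[OF cyclic[OF that] rotor_arc[OF \<rho> that], of "u v" 0] u(2)[OF that, symmetric]
    by (simp add: out_degree_def)
  then obtain k where k: "\<And>v. v \<in> N \<Longrightarrow> u v = k v * deg v"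
    by metis
  obtain h where h: "h \<in> tests" "\<And>v. v \<in> N \<Longrightarrow> drift h v < 0"
    using superharmonic by metis
  have "0 = (\<Sum>v\<in>N. \<Sum>j<u v. h (head G ((nxt ^^ Suc j) (\<rho> v))) - h v)"
    using u(3)[OF h(1)] by simp
  also have "\<dots> = (\<Sum>v\<in>N. int (k v) * drift h v)"
  proof (rule sum.cong)
    fix v assume v: "v \<in> N"
    show "(\<Sum>j<u v. h (head G ((nxt ^^ Suc j) (\<rho> v))) - h v) = int (k v) * drift h v"
      using sum_funpow_cyclic[OF cyclic[OF v] rotor_arc[OF \<rho> v], of "\<lambda>e. h (head G e) - h v" 0 "k v"]
      by (simp add: k[OF v] drift_def out_degree_def)
  qed simp
  also have "\<dots> < 0"
  proof -
    obtain v where "v \<in> N" "u v \<noteq> 0"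
      using u(1) n(1) by (metis less_irrefl sum.neutral)
    then have "int (k v) * drift h v < 0"
      using h(2) k by (intro mult_pos_neg) auto
    moreover have "(\<Sum>v\<in>N - {v}. int (k v) * drift h v) \<le> 0"
      using h(2) by (intro sum_nonpos mult_nonneg_nonpos) (auto intro: less_imp_le)
    ultimately show ?thesis
      using \<open>v \<in> N\<close> by (simp add: sum.remove[of N v])
  qed
  finally show False by simp
qed

subsection \<open>The action of chip configurations on rotor configurations\<close>

text \<open>There are finitely many pairs of a chip position and a rotor configuration, and a cycle
  among them would be a return of the one-chip configuration.\<close>

lemma wf_route_step:
  "wf {(y, x). x \<in> N \<times> rotor_configs G \<and> y = route_step G nxt x}"
proof (rule finite_acyclic_wf)
  let ?r = "{(y, x). x \<in> N \<times> rotor_configs G \<and> y = route_step G nxt x}"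
  show "finite ?r"
    by (rule finite_subset[of _ "(\<lambda>x. (route_step G nxt x, x)) ` (N \<times> rotor_configs G)"])
      (auto simp: finite_rotor_configs)
  have *: "routing\<^sup>+\<^sup>+ (chips 1 (fst x), snd x) (chips 1 (fst y), snd y)" if "(y, x) \<in> ?r\<^sup>+" for x y
    using that
  proof (induction rule: converse_trancl_induct)
    case (base y)
    then have "routing (0 + chips 1 (fst x), snd x) (0 + chips 1 (fst y), snd y)"
      using routingI[OF zero_in] by (auto simp: route_step_def)
    then show ?case
      by (simp add: tranclp.r_into_trancl)
  next
    case (step z y)
    then have "routing (0 + chips 1 (fst y), snd y) (0 + chips 1 (fst z), snd z)"
      using routingI[OF zero_in] by (auto simp: route_step_def)
    then show ?case
      using step.IH by (simp add: tranclp.trancl_into_trancl)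
  qed
  show "acyclic ?r"
    unfolding acyclic_def
  proof (intro allI notI)
    fix x assume x: "(x, x) \<in> ?r\<^sup>+"
    then have "snd x \<in> rotor_configs G"
      by cases auto
    then show False
      using routing_no_return *[OF x] by blast
  qed
qed

text \<open>The proof rule for the \<open>while\<close> loop, from which the later facts about a
  walk are derived; \<open>P\<close> relates the position of the chip to the current rotors.\<close>

lemma chip_addition_invariant:
  assumes "\<rho> \<in> rotor_configs G" "v \<in> verts G" "P v \<rho>"
    and "\<And>u \<rho>. u \<in> N \<Longrightarrow> \<rho> \<in> rotor_configs G \<Longrightarrow> P u \<rho> \<Longrightarrow>
      P (head G (nxt (\<rho> u))) (\<rho>(u := nxt (\<rho> u)))"
  shows "P s (chip_addition G s nxt v \<rho>)" and "chip_addition G s nxt v \<rho> \<in> rotor_configs G"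
proof -
  let ?x = "while (\<lambda>(u, _). u \<noteq> s) (route_step G nxt) (v, \<rho>)"
  have "fst ?x = s \<and> snd ?x \<in> rotor_configs G \<and> P (fst ?x) (snd ?x)"
  proof (rule while_rule[where P = "\<lambda>(u, \<rho>). u \<in> verts G \<and> \<rho> \<in> rotor_configs G \<and> P u \<rho>"
        and r = "{(y, x). x \<in> N \<times> rotor_configs G \<and> y = route_step G nxt x}"])
    fix x assume *: "case x of (u, \<rho>) \<Rightarrow> u \<in> verts G \<and> \<rho> \<in> rotor_configs G \<and> P u \<rho>"
      "case x of (u, _) \<Rightarrow> u \<noteq> s"
    obtain u \<tau> where x: "x = (u, \<tau>)" "u \<in> N" "\<tau> \<in> rotor_configs G" "P u \<tau>"
      using * by (cases x) (auto simp: N_eq)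
    show "case route_step G nxt x of (u, \<rho>) \<Rightarrow> u \<in> verts G \<and> \<rho> \<in> rotor_configs G \<and> P u \<rho>"
      using x assms(4)[OF x(2-4)] head_nxt_in_verts[OF x(3,2)] rotor_upd_nxt[OF x(3,2)]
      by (simp add: route_step_def)
    show "(route_step G nxt x, x) \<in> {(y, x). x \<in> N \<times> rotor_configs G \<and> y = route_step G nxt x}"
      using x by simp
  qed (use assms wf_route_step in auto)
  then show "P s (chip_addition G s nxt v \<rho>)" "chip_addition G s nxt v \<rho> \<in> rotor_configs G"
    using assms(1) by (auto simp: chip_addition_def)
qed

lemma chip_addition_in:
  "\<rho> \<in> rotor_configs G \<Longrightarrow> v \<in> verts G \<Longrightarrow> chip_addition G s nxt v \<rho> \<in> rotor_configs G"
  using chip_addition_invariant(2)[where P = "\<lambda>_ _. True"] by blast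

lemma chip_addition_routings:
  assumes "\<rho> \<in> rotor_configs G" "v \<in> verts G"
  shows "routing\<^sup>*\<^sup>* (chips 1 v, \<rho>) (0, chip_addition G s nxt v \<rho>)"
proof -
  have "routing\<^sup>*\<^sup>* (chips 1 v, \<rho>) (chips 1 s, chip_addition G s nxt v \<rho>)"
  proof (rule chip_addition_invariant(1)[OF assms])
    fix u \<rho>' assume *: "u \<in> N" "\<rho>' \<in> rotor_configs G" "routing\<^sup>*\<^sup>* (chips 1 v, \<rho>) (chips 1 u, \<rho>')"
    have "routing (0 + chips 1 u, \<rho>') (0 + chips 1 (head G (nxt (\<rho>' u))), \<rho>'(u := nxt (\<rho>' u)))"
      by (rule routingI) (use * in auto)
    then show "routing\<^sup>*\<^sup>* (chips 1 v, \<rho>) (chips 1 (head G (nxt (\<rho>' u))), \<rho>'(u := nxt (\<rho>' u)))"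
      using *(3) by (simp only: add_0 rtranclp.rtrancl_into_rtrancl)
  qed simp
  then show ?thesis by simp
qed

text \<open>Either order of composition is a complete routing of
  \<open>chips 1 v + chips 1 w\<close>, so confluence identifies the results.\<close>

lemma chip_addition_commute:
  assumes "v \<in> verts G" "w \<in> verts G"
  shows "chip_addition G s nxt v (chip_addition G s nxt w \<rho>)
    = chip_addition G s nxt w (chip_addition G s nxt v \<rho>)"
proof (cases "\<rho> \<in> rotor_configs G")
  case True
  have *: "routing\<^sup>*\<^sup>* (chips 1 v + chips 1 w, \<rho>) (0, chip_addition G s nxt w (chip_addition G s nxt v \<rho>))"
    if "v \<in> verts G" "w \<in> verts G" for v w
  proof -
    have "routing\<^sup>*\<^sup>* (chips 1 v + chips 1 w, \<rho>) (0 + chips 1 w, chip_addition G s nxt v \<rho>)"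
      by (intro routings_add chip_addition_routings that True chips_in)
    then show ?thesis
      using chip_addition_routings[OF chip_addition_in[OF True that(1)] that(2)]
      unfolding add_0 by (rule rtranclp_trans)
  qed
  show ?thesis
    by (rule routings_unique[OF *[OF assms(2,1)]]) (subst add.commute, rule *[OF assms])
qed (simp add: chip_addition_def)

lemma comp_fun_commute_chip_addition:
  "comp_fun_commute_on (verts G - {s}) (\<lambda>v. chip_addition G s nxt v ^^ \<sigma> v)"
proof -
  have "comp_fun_commute_on (verts G - {s}) (chip_addition G s nxt)"
    by standard (auto simp: fun_eq_iff chip_addition_commute)
  then show ?thesis
    by (rule comp_fun_commute_on.comp_fun_commute_on_funpow)
qed

lemma fold_chip_addition_insert:
  assumes "v \<notin> F" "v \<in> verts G - {s}" "finite F" "F \<subseteq> verts G - {s}"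
  shows "Finite_Set.fold (\<lambda>v. chip_addition G s nxt v ^^ \<sigma> v) \<rho> (insert v F)
    = (chip_addition G s nxt v ^^ \<sigma> v) (Finite_Set.fold (\<lambda>v. chip_addition G s nxt v ^^ \<sigma> v) \<rho> F)"
  using comp_fun_commute_on.fold_insert[OF comp_fun_commute_chip_addition] assms by blast

lemma chip_addition_funpow_routings:
  assumes "\<rho> \<in> rotor_configs G" "v \<in> verts G"
  shows "routing\<^sup>*\<^sup>* (chips k v, \<rho>) (0, (chip_addition G s nxt v ^^ k) \<rho>)
    \<and> (chip_addition G s nxt v ^^ k) \<rho> \<in> rotor_configs G"
proof (induction k)
  case (Suc k)
  let ?\<rho> = "(chip_addition G s nxt v ^^ k) \<rho>"
  have "routing\<^sup>*\<^sup>* (chips k v + chips 1 v, \<rho>) (0 + chips 1 v, ?\<rho>)"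
    by (rule routings_add[OF conjunct1[OF Suc] chips_in])
  moreover have "routing\<^sup>*\<^sup>* (chips 1 v, ?\<rho>) (0, chip_addition G s nxt v ?\<rho>)"
    using Suc assms(2) by (intro chip_addition_routings) auto
  ultimately have "routing\<^sup>*\<^sup>* (chips (k + 1) v, \<rho>) (0, chip_addition G s nxt v ?\<rho>)"
    unfolding chips_add add_0 by (rule rtranclp_trans)
  moreover have "chip_addition G s nxt v ?\<rho> \<in> rotor_configs G"
    using Suc assms(2) chip_addition_in by blast
  ultimately show ?case
    by (simp only: Suc_eq_plus1[symmetric] funpow.simps comp_apply)
qed (use assms in simp)

text \<open>
  By confluence this determines \<open>chip_action\<close>, in whatever order the chips are routed.
\<close>

lemma chip_action_routings:
  assumes "\<sigma> \<in> chip_configs G" "\<rho> \<in> rotor_configs G"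
  shows "routing\<^sup>*\<^sup>* (\<sigma>, \<rho>) (0, chip_action G s nxt \<sigma> \<rho>)"
proof -
  have "routing\<^sup>*\<^sup>* ((\<lambda>v. if v \<in> F then \<sigma> v else 0), \<rho>)
      (0, Finite_Set.fold (\<lambda>v. chip_addition G s nxt v ^^ \<sigma> v) \<rho> F) \<and>
      Finite_Set.fold (\<lambda>v. chip_addition G s nxt v ^^ \<sigma> v) \<rho> F \<in> rotor_configs G"
    if "finite F" "F \<subseteq> verts G - {s}" for F
    using that
  proof (induction F rule: finite_induct)
    case empty
    then show ?case
      using assms(2) by (auto simp: zero_fun_def[symmetric] simp del: zero_fun_apply)
  next
    case (insert v F)
    let ?\<sigma> = "\<lambda>v. if v \<in> F then \<sigma> v else 0"
      and ?\<rho> = "Finite_Set.fold (\<lambda>v. chip_addition G s nxt v ^^ \<sigma> v) \<rho> F"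
    have v: "v \<in> verts G - {s}" "F \<subseteq> verts G - {s}"
      using insert.prems by auto
    note IH = insert.IH[OF v(2)]
    have "routing\<^sup>*\<^sup>* (?\<sigma> + chips (\<sigma> v) v, \<rho>) (0 + chips (\<sigma> v) v, ?\<rho>)"
      by (rule routings_add[OF conjunct1[OF IH] chips_in])
    moreover have "?\<sigma> + chips (\<sigma> v) v = (\<lambda>w. if w \<in> insert v F then \<sigma> w else 0)"
      using v insert.hyps by (auto simp: chips_def fun_eq_iff N_eq)
    ultimately have "routing\<^sup>*\<^sup>* ((\<lambda>w. if w \<in> insert v F then \<sigma> w else 0), \<rho>) (chips (\<sigma> v) v, ?\<rho>)"
      by (simp only: add_0)
    moreover have "routing\<^sup>*\<^sup>* (chips (\<sigma> v) v, ?\<rho>) (0, (chip_addition G s nxt v ^^ \<sigma> v) ?\<rho>)"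
      "(chip_addition G s nxt v ^^ \<sigma> v) ?\<rho> \<in> rotor_configs G"
      using chip_addition_funpow_routings[of ?\<rho> v "\<sigma> v"] IH v(1) by blast+
    ultimately show ?case
      unfolding fold_chip_addition_insert[OF insert.hyps(2) v(1) insert.hyps(1) v(2)]
      by (blast intro: rtranclp_trans)
  qed
  from this[of "verts G - {s}"]
  have "routing\<^sup>*\<^sup>* ((\<lambda>v. if v \<in> verts G - {s} then \<sigma> v else 0), \<rho>) (0, chip_action G s nxt \<sigma> \<rho>)"
    by (simp add: chip_action_def)
  moreover have "(\<lambda>v. if v \<in> verts G - {s} then \<sigma> v else 0) = \<sigma>"
    using assms(1) by (auto simp: chip_configs_def N_eq fun_eq_iff)
  ultimately show ?thesis by (simp only:)
qed

lemma chip_action_in: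
  "\<sigma> \<in> chip_configs G \<Longrightarrow> \<rho> \<in> rotor_configs G \<Longrightarrow> chip_action G s nxt \<sigma> \<rho> \<in> rotor_configs G"
  using chip_action_routings routings_in by blast

lemma chip_action_eqI:
  "routing\<^sup>*\<^sup>* (\<sigma>, \<rho>) (0, \<rho>') \<Longrightarrow> \<sigma> \<in> chip_configs G \<Longrightarrow> \<rho> \<in> rotor_configs G \<Longrightarrow>
   chip_action G s nxt \<sigma> \<rho> = \<rho>'"
  using chip_action_routings routings_unique by blast

text \<open>Routing chips only part of the way does not change the outcome. This covers both
  stabilisation and the chips displaced in \<open>ex_routings_between\<close>.\<close>

lemma chip_action_eq_of_routings:
  assumes "routing\<^sup>*\<^sup>* (\<sigma>, \<rho>) (\<tau>, \<rho>')" "\<sigma> \<in> chip_configs G" "\<rho> \<in> rotor_configs G"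
  shows "chip_action G s nxt \<sigma> \<rho> = chip_action G s nxt \<tau> \<rho>'"
proof (rule chip_action_eqI[OF _ assms(2,3)])
  have "routing\<^sup>*\<^sup>* (\<tau>, \<rho>') (0, chip_action G s nxt \<tau> \<rho>')"
    using chip_action_routings routings_in[OF assms] by blast
  with assms(1) show "routing\<^sup>*\<^sup>* (\<sigma>, \<rho>) (0, chip_action G s nxt \<tau> \<rho>')"
    by (rule rtranclp_trans)
qed

lemma chip_action_0: "\<rho> \<in> rotor_configs G \<Longrightarrow> chip_action G s nxt 0 \<rho> = \<rho>"
  by (rule chip_action_eqI) auto

lemma chip_action_add:
  assumes "\<sigma> \<in> chip_configs G" "\<tau> \<in> chip_configs G" "\<rho> \<in> rotor_configs G"
  shows "chip_action G s nxt (\<sigma> + \<tau>) \<rho> = chip_action G s nxt \<tau> (chip_action G s nxt \<sigma> \<rho>)"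
proof -
  have "routing\<^sup>*\<^sup>* (\<sigma> + \<tau>, \<rho>) (0 + \<tau>, chip_action G s nxt \<sigma> \<rho>)"
    using chip_action_routings assms by (intro routings_add)
  then show ?thesis
    using assms by (subst chip_action_eq_of_routings) (auto simp only: add_0 add_in)
qed

lemma chip_action_chips:
  "\<rho> \<in> rotor_configs G \<Longrightarrow> v \<in> verts G \<Longrightarrow>
   chip_action G s nxt (chips 1 v) \<rho> = chip_addition G s nxt v \<rho>"
  by (intro chip_action_eqI chip_addition_routings chips_in)

lemma lattice_equiv_of_chip_action_eq:
  assumes "\<sigma> \<in> chip_configs G" "\<tau> \<in> chip_configs G" "\<rho> \<in> rotor_configs G"
    "chip_action G s nxt \<sigma> \<rho> = chip_action G s nxt \<tau> \<rho>"
  shows "lattice_equiv \<sigma> \<tau>"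
  by (rule lattice_equiv_of_routings[OF chip_action_routings[OF assms(1,3)] _ assms(3)])
    (subst assms(4), rule chip_action_routings[OF assms(2,3)])

text \<open>Chips are added so that each rotor can be advanced to its target position.\<close>

lemma ex_routings_between:
  assumes "\<rho> \<in> rotor_configs G" "\<rho>' \<in> rotor_configs G"
  shows "\<exists>\<alpha>\<in>chip_configs G. \<exists>\<beta>\<in>chip_configs G. routing\<^sup>*\<^sup>* (\<alpha>, \<rho>) (\<beta>, \<rho>')"
proof -
  have "\<exists>\<alpha>\<in>chip_configs G. \<exists>\<beta>\<in>chip_configs G. routing\<^sup>*\<^sup>* (\<alpha>, \<rho>) (\<beta>, \<lambda>v. if v \<in> F then \<rho>' v else \<rho> v)"
    if "finite F" "F \<subseteq> N" for F
    using that
  proof (induction F rule: finite_induct)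
    case empty
    then show ?case
      unfolding empty_iff if_False using zero_in by blast
  next
    case (insert v F)
    let ?\<rho> = "\<lambda>v. if v \<in> F then \<rho>' v else \<rho> v"
    have v: "v \<in> N"
      using insert.prems by simp
    obtain \<alpha> \<beta> where \<alpha>\<beta>: "\<alpha> \<in> chip_configs G" "\<beta> \<in> chip_configs G" "routing\<^sup>*\<^sup>* (\<alpha>, \<rho>) (\<beta>, ?\<rho>)"
      using insert by auto
    have \<rho>: "?\<rho> \<in> rotor_configs G"
      using routings_in[OF \<alpha>\<beta>(3,1) assms(1)] by simp
    have "\<rho>' v \<in> orbit nxt (\<rho> v)"
      using orbit_cyclic_eq3[OF cyclic[OF v] rotor_arc[OF assms(1) v]] rotor_arc[OF assms(2) v]
      by (simp del: in_out_arcs_conv)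
    then obtain k where "\<rho>' v = (nxt ^^ k) (\<rho> v)"
      by (auto simp: orbit_altdef)
    then have upd: "?\<rho>(v := (nxt ^^ k) (?\<rho> v)) = (\<lambda>w. if w \<in> insert v F then \<rho>' w else \<rho> w)"
      using insert.hyps by (auto simp: fun_eq_iff)
    obtain \<gamma> where \<gamma>: "routing\<^sup>*\<^sup>* (\<beta> + chips k v, ?\<rho>) (\<gamma>, ?\<rho>(v := (nxt ^^ k) (?\<rho> v)))"
      using routings_at[OF \<alpha>\<beta>(2) v \<rho>] by blast
    have "routing\<^sup>*\<^sup>* (\<alpha> + chips k v, \<rho>) (\<gamma>, \<lambda>w. if w \<in> insert v F then \<rho>' w else \<rho> w)"
      using routings_add[OF \<alpha>\<beta>(3) chips_in] \<gamma> unfolding upd by (rule rtranclp_trans)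
    moreover from this have "\<gamma> \<in> chip_configs G"
      using routings_in \<alpha>\<beta>(1) assms(1) add_in chips_in by blast
    ultimately show ?case
      using \<alpha>\<beta>(1) add_in chips_in by blast
  qed
  from this[of N] obtain \<alpha> \<beta> where *: "\<alpha> \<in> chip_configs G" "\<beta> \<in> chip_configs G"
    "routing\<^sup>*\<^sup>* (\<alpha>, \<rho>) (\<beta>, \<lambda>v. if v \<in> N then \<rho>' v else \<rho> v)"
    by auto
  moreover have "(\<lambda>v. if v \<in> N then \<rho>' v else \<rho> v) = \<rho>'"
    using assms by (auto simp: rotor_configs_def PiE_def extensional_def fun_eq_iff)
  ultimately show ?thesis
    by auto
qed

subsection \<open>Chip addition permutes the spanning trees\<close>

text \<open>
  An auxiliary edge from the sink to \<open>v\<close> turns a spanning tree into a unicycle. While a chip added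
  at \<open>v\<close> travels, every vertex keeps leading to its location, and the previous location is the
  predecessor on the cycle through the current one; so the walk can be reversed.
\<close>

definition successor :: "'a \<Rightarrow> ('a \<Rightarrow> 'b) \<Rightarrow> 'a \<Rightarrow> 'a" where
  "successor v \<rho> = (\<lambda>x. if x = s then v else head G (\<rho> x))"

definition leads_to :: "'a \<Rightarrow> ('a \<Rightarrow> 'b) \<Rightarrow> 'a \<Rightarrow> bool" where
  "leads_to v \<rho> u \<longleftrightarrow> (\<forall>x\<in>verts G. \<exists>k. (successor v \<rho> ^^ k) x = u)"

text \<open>At the sink the chip takes the auxiliary edge to \<open>v\<close> and no rotor turns.
  Routing thereby becomes a self-map of \<open>unicycles v\<close>, and \<open>chip_addition\<close>
  its first-return map to the sink.\<close>

definition cyclic_step :: "'a \<Rightarrow> 'a \<times> ('a \<Rightarrow> 'b) \<Rightarrow> 'a \<times> ('a \<Rightarrow> 'b)" where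
  "cyclic_step v x = (if fst x = s then (v, snd x) else route_step G nxt x)"

definition unicycles :: "'a \<Rightarrow> ('a \<times> ('a \<Rightarrow> 'b)) set" where
  "unicycles v = {(u, \<rho>). u \<in> verts G \<and> \<rho> \<in> rotor_configs G \<and> leads_to v \<rho> u}"

text \<open>Every vertex still reaches \<open>u\<close>, whose new successor is \<open>w\<close>;
  this is the invariant of the walk.\<close>

lemma leads_to_next:
  assumes "leads_to v \<rho> u" "successor v \<rho>' = (successor v \<rho>)(u := w)"
  shows "leads_to v \<rho>' w"
  unfolding leads_to_def
proof
  fix x assume "x \<in> verts G"
  then obtain k where "(successor v \<rho>' ^^ k) x = u"
    using assms funpow_reach_fun_upd unfolding leads_to_def by metis
  then have "(successor v \<rho>' ^^ Suc k) x = w"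
    using assms(2) by simp
  then show "\<exists>k. (successor v \<rho>' ^^ k) x = w" ..
qed

text \<open>The auxiliary edge leaves the sink and so cannot matter for reaching it. The choice
  \<open>successor s\<close>, a loop at the sink, is the one compared with acyclicity.\<close>

lemma leads_to_sink_iff: "leads_to v \<rho> s \<longleftrightarrow> leads_to w \<rho> s"
proof -
  have *: "leads_to v \<rho> s \<Longrightarrow> leads_to w \<rho> s" for v w
  proof -
    have "successor w \<rho> = (successor v \<rho>)(s := w)"
      by (auto simp: successor_def)
    then show "leads_to v \<rho> s \<Longrightarrow> leads_to w \<rho> s"
      using funpow_reach_fun_upd unfolding leads_to_def by metis
  qed
  show ?thesis
    using * by blast
qed

lemma successor_upd:
  "u \<in> N \<Longrightarrow> successor v (\<rho>(u := e)) = (successor v \<rho>)(u := head G e)"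
  using s_notin_N by (auto simp: successor_def fun_eq_iff)

lemma cyclic_step_successor:
  assumes "(u, \<rho>) \<in> unicycles v" "cyclic_step v (u, \<rho>) = (w, \<rho>')"
  shows "successor v \<rho>' = (successor v \<rho>)(u := w)"
proof (cases "u = s")
  case True
  then show ?thesis
    using assms by (auto simp: cyclic_step_def successor_def)
next
  case False
  then have "u \<in> N"
    using assms(1) by (simp add: unicycles_def N_eq)
  then show ?thesis
    using assms(2) False successor_upd by (auto simp: cyclic_step_def route_step_def)
qed

lemma cyclic_step_in:
  assumes "v \<in> verts G" "x \<in> unicycles v"
  shows "cyclic_step v x \<in> unicycles v"
proof -
  obtain u \<rho> w \<rho>' where x: "x = (u, \<rho>)" "cyclic_step v x = (w, \<rho>')"
    by (metis surj_pair)
  have u: "u \<in> verts G" "\<rho> \<in> rotor_configs G" "leads_to v \<rho> u"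
    using assms(2) x(1) by (auto simp: unicycles_def)
  have "leads_to v \<rho>' w"
    using leads_to_next u(3) cyclic_step_successor assms(2) x by metis
  moreover have "w \<in> verts G \<and> \<rho>' \<in> rotor_configs G"
  proof (cases "u = s")
    case True
    then show ?thesis
      using x u assms(1) by (auto simp: cyclic_step_def)
  next
    case False
    then have "u \<in> N"
      using u by (simp add: N_eq)
    then show ?thesis
      using x u False head_nxt_in_verts rotor_upd_nxt by (auto simp: cyclic_step_def route_step_def)
  qed
  ultimately show ?thesis
    using x by (simp add: unicycles_def)
qed

lemma inj_on_cyclic_step:
  assumes "v \<in> verts G"
  shows "inj_on (cyclic_step v) (unicycles v)"
proof (rule inj_onI)
  fix x y assume xy: "x \<in> unicycles v" "y \<in> unicycles v" "cyclic_step v x = cyclic_step v y"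
  obtain u \<rho> where x: "x = (u, \<rho>)" by (cases x)
  obtain u' \<tau> where y: "y = (u', \<tau>)" by (cases y)
  obtain w \<rho>' where w: "cyclic_step v x = (w, \<rho>')" by (cases "cyclic_step v x")
  let ?f = "successor v \<rho>'"
  have wv: "w \<in> verts G"
    using cyclic_step_in[OF assms xy(1)] w by (simp add: unicycles_def)
  \<comment> \<open>\<open>w\<close> reached \<open>u\<close> before the step and still does after
    it, and now \<open>u\<close> points to \<open>w\<close>: both lie on one cycle of
    \<open>?f\<close>, where \<open>w\<close> determines \<open>u\<close>.\<close>
  have "\<exists>k. (?f ^^ k) w = u \<and> ?f u = w" if st: "(u, \<rho>) \<in> unicycles v" "cyclic_step v (u, \<rho>) = (w, \<rho>')" for u \<rho>
  proof -
    obtain k where "(successor v \<rho> ^^ k) w = u"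
      using st(1) wv unfolding unicycles_def leads_to_def by blast
    then have "\<exists>k. ((successor v \<rho>)(u := w) ^^ k) w = u"
      by (rule funpow_reach_fun_upd)
    then show ?thesis
      unfolding cyclic_step_successor[OF st] by (simp del: fun_upd_apply add: fun_upd_same)
  qed
  then have u: "u = u'"
    using funpow_cycle_predecessor_unique xy w unfolding x y by metis
  show "x = y"
  proof (cases "u = s")
    case True
    then show ?thesis
      using xy(3) u unfolding x y by (simp add: cyclic_step_def)
  next
    case False
    then have uN: "u \<in> N" and \<rho>: "\<rho> \<in> rotor_configs G" "\<tau> \<in> rotor_configs G"
      using xy u unfolding x y by (auto simp: unicycles_def N_eq)
    have eq: "\<rho>(u := nxt (\<rho> u)) = \<tau>(u := nxt (\<tau> u))"
      using xy(3) u False unfolding x y by (simp add: cyclic_step_def route_step_def)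
    then have "nxt (\<rho> u) = nxt (\<tau> u)"
      by (metis fun_upd_same)
    then have "\<rho> u = \<tau> u"
      using cyclic_on_imp_bij_betw[OF cyclic[OF uN]] rotor_arc[OF \<rho>(1) uN] rotor_arc[OF \<rho>(2) uN]
      by (metis bij_betw_imp_inj_on inj_onD)
    then have "\<rho> = \<tau>"
      using eq by (metis fun_upd_triv fun_upd_upd)
    then show ?thesis
      using x y u by simp
  qed
qed

lemma funpow_cyclic_step_in:
  "v \<in> verts G \<Longrightarrow> x \<in> unicycles v \<Longrightarrow> (cyclic_step v ^^ k) x \<in> unicycles v"
  by (induction k) (auto simp: cyclic_step_in)

text \<open>The extra \<open>Suc\<close> is the initial step along the auxiliary edge. The second
  conjunct makes this return to the sink the first one.\<close>

lemma chip_addition_first_return: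
  assumes "\<rho> \<in> rotor_configs G" "v \<in> verts G"
  shows "\<exists>k. (cyclic_step v ^^ Suc k) (s, \<rho>) = (s, chip_addition G s nxt v \<rho>) \<and>
    (\<forall>i\<in>{1..k}. fst ((cyclic_step v ^^ i) (s, \<rho>)) \<noteq> s)"
proof (rule chip_addition_invariant(1)[OF assms, where P = "\<lambda>u \<tau>. \<exists>k.
      (cyclic_step v ^^ Suc k) (s, \<rho>) = (u, \<tau>) \<and>
      (\<forall>i\<in>{1..k}. fst ((cyclic_step v ^^ i) (s, \<rho>)) \<noteq> s)"])
  show "\<exists>k. (cyclic_step v ^^ Suc k) (s, \<rho>) = (v, \<rho>) \<and>
    (\<forall>i\<in>{1..k}. fst ((cyclic_step v ^^ i) (s, \<rho>)) \<noteq> s)"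
    by (intro exI[of _ 0]) (simp add: cyclic_step_def)
next
  fix u \<tau> assume u: "u \<in> N" and "\<exists>k. (cyclic_step v ^^ Suc k) (s, \<rho>) = (u, \<tau>) \<and>
    (\<forall>i\<in>{1..k}. fst ((cyclic_step v ^^ i) (s, \<rho>)) \<noteq> s)"
  then obtain k where k: "(cyclic_step v ^^ Suc k) (s, \<rho>) = (u, \<tau>)"
    "\<forall>i\<in>{1..k}. fst ((cyclic_step v ^^ i) (s, \<rho>)) \<noteq> s"
    by blast
  have us: "u \<noteq> s"
    using u s_notin_N by blast
  have "(cyclic_step v ^^ Suc (Suc k)) (s, \<rho>) = cyclic_step v (u, \<tau>)"
    using k(1) by simp
  also have "\<dots> = (head G (nxt (\<tau> u)), \<tau>(u := nxt (\<tau> u)))"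
    using us by (simp add: cyclic_step_def route_step_def)
  finally have "(cyclic_step v ^^ Suc (Suc k)) (s, \<rho>) = (head G (nxt (\<tau> u)), \<tau>(u := nxt (\<tau> u)))" .
  moreover have "\<forall>i\<in>{1..Suc k}. fst ((cyclic_step v ^^ i) (s, \<rho>)) \<noteq> s"
    using k us by (metis atLeastAtMost_iff fst_conv le_SucE)
  ultimately show "\<exists>k. (cyclic_step v ^^ Suc k) (s, \<rho>) = (head G (nxt (\<tau> u)), \<tau>(u := nxt (\<tau> u))) \<and>
    (\<forall>i\<in>{1..k}. fst ((cyclic_step v ^^ i) (s, \<rho>)) \<noteq> s)"
    by blast
qed

text \<open>A first-return map of an injective map is injective: cancelling the steps of the shorter
  walk would otherwise put its starting state on the longer walk before that walk's first
  return.\<close>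

lemma chip_addition_inj:
  assumes "v \<in> verts G" "(s, \<rho>) \<in> unicycles v" "(s, \<tau>) \<in> unicycles v"
    "chip_addition G s nxt v \<rho> = chip_addition G s nxt v \<tau>"
  shows "\<rho> = \<tau>"
proof -
  have *: "\<rho> = \<tau>"
    if "(s, \<rho>) \<in> unicycles v" "(s, \<tau>) \<in> unicycles v" "k \<le> l"
      "(cyclic_step v ^^ Suc k) (s, \<rho>) = (cyclic_step v ^^ Suc l) (s, \<tau>)"
      "\<forall>i\<in>{1..l}. fst ((cyclic_step v ^^ i) (s, \<tau>)) \<noteq> s" for k l \<rho> \<tau>
  proof -
    have "inj_on (cyclic_step v ^^ n) (unicycles v)" for n
      using inj_on_cyclic_step[OF assms(1)] cyclic_step_in[OF assms(1)]
      by (intro inj_on_funpow_self) auto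
    moreover have "(cyclic_step v ^^ Suc l) (s, \<tau>)
        = (cyclic_step v ^^ Suc k) ((cyclic_step v ^^ (l - k)) (s, \<tau>))"
      using that(3) by (metis (no_types) Suc_le_mono add.commute comp_apply diff_Suc_Suc funpow_add le_add_diff_inverse2)
    ultimately have eq: "(s, \<rho>) = (cyclic_step v ^^ (l - k)) (s, \<tau>)"
      using that(1,2,4) funpow_cyclic_step_in[OF assms(1)] by (metis inj_onD)
    have "l - k = 0"
    proof (rule ccontr)
      assume "l - k \<noteq> 0"
      then have "l - k \<in> {1..l}"
        by simp
      then show False
        using that(5) eq by (metis fst_conv)
    qed
    then show ?thesis
      using eq by simp
  qed
  obtain k where k: "(cyclic_step v ^^ Suc k) (s, \<rho>) = (s, chip_addition G s nxt v \<rho>)"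
    "\<forall>i\<in>{1..k}. fst ((cyclic_step v ^^ i) (s, \<rho>)) \<noteq> s"
    using chip_addition_first_return assms(1,2) by (metis (no_types, lifting) case_prodD mem_Collect_eq unicycles_def)
  obtain l where l: "(cyclic_step v ^^ Suc l) (s, \<tau>) = (s, chip_addition G s nxt v \<tau>)"
    "\<forall>i\<in>{1..l}. fst ((cyclic_step v ^^ i) (s, \<tau>)) \<noteq> s"
    using chip_addition_first_return assms(1,3) by (metis (no_types, lifting) case_prodD mem_Collect_eq unicycles_def)
  show ?thesis
    using *[OF assms(2,3), of k l] *[OF assms(3,2), of l k] k l assms(4) by (metis nat_le_linear)
qed

lemma chip_addition_unicycles:
  assumes "v \<in> verts G" "(s, \<rho>) \<in> unicycles v"
  shows "(s, chip_addition G s nxt v \<rho>) \<in> unicycles v"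
proof -
  have "\<rho> \<in> rotor_configs G"
    using assms(2) by (simp add: unicycles_def)
  then obtain k where "(cyclic_step v ^^ Suc k) (s, \<rho>) = (s, chip_addition G s nxt v \<rho>)"
    using chip_addition_first_return assms(1) by blast
  then show ?thesis
    using funpow_cyclic_step_in[OF assms] by metis
qed

section \<open>Acyclic rotor configurations as those leading to the sink\<close>

lemma rotor_graph_simps [simp]:
  "verts (rotor_graph G \<rho>) = verts G" "arcs (rotor_graph G \<rho>) = \<rho> ` N"
  "tail (rotor_graph G \<rho>) = tail G" "head (rotor_graph G \<rho>) = head G"
  by (simp_all add: rotor_graph_def)

lemma wf_rotor_graph: "\<rho> \<in> rotor_configs G \<Longrightarrow> wf_digraph (rotor_graph G \<rho>)"
  using rotor_arc by unfold_locales (fastforce simp: N_eq)+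

lemma tail_rotor: "\<rho> \<in> rotor_configs G \<Longrightarrow> v \<in> N \<Longrightarrow> tail G (\<rho> v) = v"
  using rotor_arc by fastforce

lemma awalk_rotor_graph:
  assumes "\<rho> \<in> rotor_configs G" "x \<in> verts G" "\<And>i. i < k \<Longrightarrow> (successor s \<rho> ^^ i) x \<noteq> s"
  shows "pre_digraph.awalk (rotor_graph G \<rho>) x (map (\<lambda>i. \<rho> ((successor s \<rho> ^^ i) x)) [0..<k])
    ((successor s \<rho> ^^ k) x)"
  using assms(3)
proof (induction k)
  interpret T: wf_digraph "rotor_graph G \<rho>"
    by (rule wf_rotor_graph) fact
  {
    case 0
    then show ?case
      using assms(2) by (simp add: T.awalk_Nil_iff)
  next
    case (Suc k)
    let ?y = "(successor s \<rho> ^^ k) x"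
    have y: "?y \<in> verts G"
      using T.awalk_last_in_verts[OF Suc.IH] Suc.prems by simp
    then have yN: "?y \<in> N"
      using Suc.prems[of k] by (simp add: N_eq)
    have "T.awalk ?y [\<rho> ?y] ((successor s \<rho> ^^ Suc k) x)"
      using yN tail_rotor[OF assms(1) yN] Suc.prems[of k] y rotor_arc[OF assms(1) yN]
      by (auto simp: T.awalk_Cons_iff T.awalk_Nil_iff successor_def)
    then show ?case
      using T.awalk_appendI[OF Suc.IH] Suc.prems by simp
  }
qed

lemma awalk_rotor_graph_end:
  assumes "\<rho> \<in> rotor_configs G" "pre_digraph.awalk (rotor_graph G \<rho>) u p w"
  shows "(successor s \<rho> ^^ length p) u = w"
  using assms(2)
proof (induction p arbitrary: u)
  interpret T: wf_digraph "rotor_graph G \<rho>"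
    by (rule wf_rotor_graph) fact
  {
    case Nil
    then show ?case by (simp add: T.awalk_Nil_iff)
  next
    case (Cons e p)
    then have e: "e \<in> \<rho> ` N" "u = tail G e" "T.awalk (head G e) p w"
      by (auto simp: T.awalk_Cons_iff)
    then have "e = \<rho> u" "u \<in> N"
      using tail_rotor[OF assms(1)] by auto
    then have "u \<noteq> s"
      using s_notin_N by blast
    then have "successor s \<rho> u = head G e"
      using \<open>e = \<rho> u\<close> by (simp add: successor_def)
    then show ?case
      using Cons.IH[OF e(3)] by (simp add: funpow_swap1)
  }
qed

text \<open>Each non-sink vertex has exactly one rotor edge. Following these edges without ever
  meeting the sink repeats a vertex and closes a cycle; conversely a vertex on a cycle keeps coming
  back, while the sink is a fixed point of \<open>successor s \<rho>\<close>.\<close>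

lemma acyclic_iff_leads_to_sink:
  "\<rho> \<in> acyclic_rotor_configs G \<longleftrightarrow> \<rho> \<in> rotor_configs G \<and> leads_to s \<rho> s"
proof (cases "\<rho> \<in> rotor_configs G")
  case \<rho>: True
  interpret T: wf_digraph "rotor_graph G \<rho>"
    by (rule wf_rotor_graph) fact
  let ?f = "successor s \<rho>"
  have "leads_to s \<rho> s \<longleftrightarrow> (\<nexists>p. T.cycle p)"
  proof
    assume lead: "leads_to s \<rho> s"
    show "\<nexists>p. T.cycle p"
    proof
      assume "\<exists>p. T.cycle p"
      then obtain p u where p: "T.awalk u p u" "p \<noteq> []"
        by (auto simp: T.cycle_def)
      have "u \<in> N"
        using p tail_rotor[OF \<rho>] by (cases p) (auto simp: T.awalk_Cons_iff)
      then obtain k where k: "(?f ^^ k) u = s"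
        using lead by (auto simp: leads_to_def N_eq)
      have abs: "(?f ^^ n) s = s" for n
        by (induction n) (auto simp: successor_def)
      \<comment> \<open>The exponent is a multiple of the cycle length and at least
        \<open>k\<close>, so \<open>u\<close> is both back at itself and absorbed at the
        sink.\<close>
      have "(?f ^^ (length p * k)) u = u"
        using awalk_rotor_graph_end[OF \<rho> p(1)] by (metis funpow_0 funpow_mod_eq mod_mult_self1_is_0)
      moreover have "(?f ^^ (length p * k)) u = s"
      proof -
        have "k \<le> length p * k"
          using p(2) by (cases p) auto
        then show ?thesis
          using k abs by (metis comp_apply funpow_add le_add_diff_inverse2)
      qed
      ultimately show False
        using \<open>u \<in> N\<close> s_notin_N by metis
    qed
  next
    assume no: "\<nexists>p. T.cycle p"
    show "leads_to s \<rho> s"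
      unfolding leads_to_def
    proof (rule ballI, rule ccontr)
      fix x assume x: "x \<in> verts G" and "\<not> (\<exists>k. (?f ^^ k) x = s)"
      then have ns: "(?f ^^ k) x \<noteq> s" for k
        by blast
      have walk: "T.awalk y (map (\<lambda>i. \<rho> ((?f ^^ i) y)) [0..<k]) ((?f ^^ k) y)"
        if "y = (?f ^^ i) x" "y \<in> verts G" for y i k
        using awalk_rotor_graph[OF \<rho> that(2)] ns unfolding that(1) by (metis comp_apply funpow_add)
      have vert: "(?f ^^ k) x \<in> verts G" for k
        using T.awalk_last_in_verts[OF walk[of x 0 k]] x by simp
      have "\<not> inj (\<lambda>k. (?f ^^ k) x)"
        using vert by (metis finite_imageD finite_subset finite_verts image_subsetI infinite_UNIV_nat)
      then obtain i j where ij: "i < j" "(?f ^^ i) x = (?f ^^ j) x"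
        unfolding inj_def by (metis linorder_neqE_nat)
      define y where "y = (?f ^^ i) x"
      have "(?f ^^ (j - i)) y = y"
        using ij unfolding y_def by (metis comp_apply funpow_add le_add_diff_inverse2 less_imp_le)
      then have "T.closed_w (map (\<lambda>k. \<rho> ((?f ^^ k) y)) [0..<j - i])"
        using walk[OF y_def, of "j - i"] vert[of i] ij(1) unfolding T.closed_w_def y_def by auto
      then show False
        using no T.closed_w_imp_cycle by blast
    qed
  qed
  then show ?thesis
    using \<rho> by (simp add: acyclic_rotor_configs_def)
qed (simp add: acyclic_rotor_configs_def)

lemma acyclic_iff_unicycles: "(s, \<rho>) \<in> unicycles v \<longleftrightarrow> \<rho> \<in> acyclic_rotor_configs G"
  using leads_to_sink_iff by (auto simp: unicycles_def acyclic_iff_leads_to_sink)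

lemma acyclic_rotor_configs_subset: "\<rho> \<in> acyclic_rotor_configs G \<Longrightarrow> \<rho> \<in> rotor_configs G"
  by (simp add: acyclic_rotor_configs_def)

lemma chip_action_acyclic:
  assumes "\<sigma> \<in> chip_configs G"
  shows "chip_action G s nxt \<sigma> \<in> acyclic_rotor_configs G \<rightarrow> acyclic_rotor_configs G"
    and "inj_on (chip_action G s nxt \<sigma>) (acyclic_rotor_configs G)"
proof -
  let ?A = "acyclic_rotor_configs G"
  have "chip_action G s nxt \<sigma> \<in> ?A \<rightarrow> ?A \<and> inj_on (chip_action G s nxt \<sigma>) ?A"
    using assms
  proof (induction rule: chip_configs_induct)
    case zero
    have "\<rho> \<in> ?A \<Longrightarrow> chip_action G s nxt 0 \<rho> = \<rho>" for \<rho>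
      using chip_action_0 acyclic_rotor_configs_subset by blast
    then show ?case
      by (simp add: inj_on_def del: zero_fun_apply)
  next
    case (add \<kappa> v)
    have v: "v \<in> verts G"
      using add.hyps(2) by (simp add: N_eq)
    have eq: "chip_action G s nxt (\<kappa> + chips 1 v) \<rho>
        = chip_addition G s nxt v (chip_action G s nxt \<kappa> \<rho>)" if "\<rho> \<in> ?A" for \<rho>
      using that chip_action_add[OF add.hyps(1) chips_in] chip_action_chips[OF _ v] chip_action_in[OF add.hyps(1)]
        acyclic_rotor_configs_subset by metis
    have E: "chip_addition G s nxt v \<rho> \<in> ?A" if "\<rho> \<in> ?A" for \<rho>
      using chip_addition_unicycles[OF v] that unfolding acyclic_iff_unicycles .
    have inj: "\<rho> = \<tau>" if "\<rho> \<in> ?A" "\<tau> \<in> ?A" "chip_addition G s nxt v \<rho> = chip_addition G s nxt v \<tau>" for \<rho> \<tau>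
      using chip_addition_inj[OF v] that unfolding acyclic_iff_unicycles by blast
    show ?case
    proof
      show "chip_action G s nxt (\<kappa> + chips 1 v) \<in> ?A \<rightarrow> ?A"
      proof
        fix \<rho> assume "\<rho> \<in> ?A"
        then show "chip_action G s nxt (\<kappa> + chips 1 v) \<rho> \<in> ?A"
          using add.IH E unfolding eq[OF \<open>\<rho> \<in> ?A\<close>] by blast
      qed
      show "inj_on (chip_action G s nxt (\<kappa> + chips 1 v)) ?A"
      proof (rule inj_onI)
        fix \<rho> \<tau> assume *: "\<rho> \<in> ?A" "\<tau> \<in> ?A"
          "chip_action G s nxt (\<kappa> + chips 1 v) \<rho> = chip_action G s nxt (\<kappa> + chips 1 v) \<tau>"
        have "chip_action G s nxt \<kappa> \<rho> = chip_action G s nxt \<kappa> \<tau>"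
        proof (rule inj)
          show "chip_action G s nxt \<kappa> \<rho> \<in> ?A" "chip_action G s nxt \<kappa> \<tau> \<in> ?A"
            using add.IH *(1,2) by blast+
          show "chip_addition G s nxt v (chip_action G s nxt \<kappa> \<rho>)
              = chip_addition G s nxt v (chip_action G s nxt \<kappa> \<tau>)"
            using *(3) unfolding eq[OF *(1)] eq[OF *(2)] .
        qed
        then show "\<rho> = \<tau>"
          using add.IH *(1,2) by (blast dest: inj_onD)
      qed
    qed
  qed
  then show "chip_action G s nxt \<sigma> \<in> ?A \<rightarrow> ?A" "inj_on (chip_action G s nxt \<sigma>) ?A"
    by auto
qed

subsection \<open>Recurrent configurations and spanning trees\<close>

lemma chip_action_multiple:
  assumes "\<sigma> \<in> chip_configs G" "\<rho> \<in> rotor_configs G"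
  shows "chip_action G s nxt (\<lambda>v. m * \<sigma> v) \<rho> = (chip_action G s nxt \<sigma> ^^ m) \<rho>"
proof (induction m)
  case 0
  then show ?case
    using chip_action_0[OF assms(2)] by (simp add: zero_fun_def)
next
  case (Suc m)
  have in': "(\<lambda>v. m * \<sigma> v) \<in> chip_configs G"
    using assms(1) by (simp add: chip_configs_def)
  have "(\<lambda>v. Suc m * \<sigma> v) = (\<lambda>v. m * \<sigma> v) + \<sigma>"
    by (simp add: fun_eq_iff)
  then show ?case
    using chip_action_add[OF in' assms(1,2)] Suc by (simp only: funpow.simps comp_apply)
qed

lemma ex_recurrent_between:
  assumes "\<rho> \<in> acyclic_rotor_configs G" "\<rho>' \<in> acyclic_rotor_configs G"
  shows "\<exists>\<sigma>\<in>recurrent_configs G. chip_action G s nxt \<sigma> \<rho> = \<rho>'"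
proof -
  have \<rho>: "\<rho> \<in> rotor_configs G" "\<rho>' \<in> rotor_configs G"
    using assms acyclic_rotor_configs_subset by auto
  obtain \<alpha> \<beta> where \<alpha>\<beta>: "\<alpha> \<in> chip_configs G" "\<beta> \<in> chip_configs G" "routing\<^sup>*\<^sup>* (\<alpha>, \<rho>) (\<beta>, \<rho>')"
    using ex_routings_between[OF \<rho>] by blast
  have act: "chip_action G s nxt \<alpha> \<rho> = chip_action G s nxt \<beta> \<rho>'"
    by (rule chip_action_eq_of_routings[OF \<alpha>\<beta>(3,1) \<rho>(1)])
  \<comment> \<open>One full out-degree at each vertex makes the final sum large enough for
    \<open>ex_recurrent_stabilization\<close>.\<close>
  define \<delta> where "\<delta> v = (if v \<in> N then deg v else 0)" for v
  have \<delta>: "\<delta> \<in> chip_configs G"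
    by (simp add: \<delta>_def chip_configs_def)
  have fin: "finite (acyclic_rotor_configs G)"
    using finite_rotor_configs acyclic_rotor_configs_subset by (meson finite_subset subsetI)
  obtain m where m: "m > 0" "(chip_action G s nxt (\<beta> + \<delta>) ^^ m) \<rho>' = \<rho>'"
    using funpow_self_return[OF chip_action_acyclic(2,1) fin assms(2)] \<alpha>\<beta>(2) \<delta> add_in by blast
  \<comment> \<open>One copy of \<open>\<beta> + \<delta>\<close> is already present;
    \<open>m - 1\<close> further copies complete the \<open>m\<close> applications that bring
    \<rho>' back.\<close>
  define \<gamma> where "\<gamma> = (\<lambda>v. (m - 1) * (\<beta> + \<delta>) v)"
  have \<gamma>: "\<gamma> \<in> chip_configs G"
    using add_in[OF \<alpha>\<beta>(2) \<delta>] by (simp add: \<gamma>_def chip_configs_def)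
  have "chip_action G s nxt (\<alpha> + (\<delta> + \<gamma>)) \<rho> = chip_action G s nxt (\<beta> + (\<delta> + \<gamma>)) \<rho>'"
    using act \<alpha>\<beta>(1,2) \<delta> \<gamma> \<rho> by (simp add: chip_action_add del: plus_fun_apply)
  also have "\<beta> + (\<delta> + \<gamma>) = (\<lambda>v. m * (\<beta> + \<delta>) v)"
    using m(1) by (cases m) (auto simp: \<gamma>_def fun_eq_iff)
  also have "chip_action G s nxt \<dots> \<rho>' = \<rho>'"
    using chip_action_multiple[OF add_in[OF \<alpha>\<beta>(2) \<delta>] \<rho>(2)] m(2) by simp
  finally have big: "chip_action G s nxt (\<alpha> + (\<delta> + \<gamma>)) \<rho> = \<rho>'" .
  have in': "\<alpha> + (\<delta> + \<gamma>) \<in> chip_configs G"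
    using \<alpha>\<beta>(1) \<delta> \<gamma> add_in by blast
  have "deg v \<le> (\<alpha> + (\<delta> + \<gamma>)) v" if "v \<in> N" for v
    using that by (simp add: \<delta>_def)
  then obtain \<sigma> where \<sigma>: "\<sigma> \<in> recurrent_configs G" "firing\<^sup>*\<^sup>* (\<alpha> + (\<delta> + \<gamma>)) \<sigma>"
    using ex_recurrent_stabilization[OF in'] by blast
  then have "chip_action G s nxt \<sigma> \<rho> = \<rho>'"
    using chip_action_eq_of_routings[OF firings_imp_routings[OF \<sigma>(2) \<rho>(1)] in' \<rho>(1)] big by simp
  then show ?thesis
    using \<sigma>(1) by blast
qed

lemma recurrent_in: "\<sigma> \<in> recurrent_configs G \<Longrightarrow> \<sigma> \<in> chip_configs G"
  by (simp add: recurrent_configs_def)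

lemma bij_betw_recurrent_acyclic:
  assumes "\<rho> \<in> acyclic_rotor_configs G"
  shows "bij_betw (\<lambda>\<sigma>. chip_action G s nxt \<sigma> \<rho>) (recurrent_configs G) (acyclic_rotor_configs G)"
proof (rule bij_betw_imageI)
  show "inj_on (\<lambda>\<sigma>. chip_action G s nxt \<sigma> \<rho>) (recurrent_configs G)"
    using recurrent_unique lattice_equiv_of_chip_action_eq recurrent_in
      acyclic_rotor_configs_subset[OF assms] by (meson inj_onI)
  show "(\<lambda>\<sigma>. chip_action G s nxt \<sigma> \<rho>) ` recurrent_configs G = acyclic_rotor_configs G"
    using ex_recurrent_between[OF assms] chip_action_acyclic(1)[OF recurrent_in] assms by fastforce
qed

text \<open>The zero configuration fixes \<rho> just as \<sigma> does, which puts \<sigma> into the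
  class of \<open>0\<close>; uniqueness within a class then identifies it with the described
  element.\<close>

lemma recurrent_identity_eq:
  assumes "\<rho> \<in> acyclic_rotor_configs G" "\<sigma> \<in> recurrent_configs G" "chip_action G s nxt \<sigma> \<rho> = \<rho>"
  shows "recurrent_identity G = \<sigma>" and "sandpile_class G \<sigma> = \<one>\<^bsub>sandpile_group G\<^esub>"
proof -
  have "chip_action G s nxt \<sigma> \<rho> = chip_action G s nxt 0 \<rho>"
    using assms chip_action_0 acyclic_rotor_configs_subset by metis
  then have \<sigma>0: "lattice_equiv \<sigma> 0"
    using lattice_equiv_of_chip_action_eq recurrent_in[OF assms(2)] zero_in
      acyclic_rotor_configs_subset[OF assms(1)] by blast
  then show one: "sandpile_class G \<sigma> = \<one>\<^bsub>sandpile_group G\<^esub>"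
    by (simp add: sandpile_class_eq_one_iff del: zero_fun_apply)
  show "recurrent_identity G = \<sigma>"
    unfolding recurrent_identity_def
  proof (rule the_equality)
    fix \<tau> assume \<tau>: "\<tau> \<in> recurrent_configs G \<and> sandpile_class G \<tau> = \<one>\<^bsub>sandpile_group G\<^esub>"
    then have "lattice_equiv \<tau> 0"
      using sandpile_class_eq_one_iff by blast
    then have "lattice_equiv \<tau> \<sigma>"
      using \<sigma>0 lattice_equiv_sym lattice_equiv_trans by blast
    then show "\<tau> = \<sigma>"
      using recurrent_unique \<tau> assms(2) by blast
  qed (use assms one in blast)
qed

end

theorem mainTheorem6:
  fixes G :: "('a,'b) pre_digraph" and s :: 'a and nxt :: "'b \<Rightarrow> 'b" and \<rho> :: "'a \<Rightarrow> 'b"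
  assumes "fin_digraph G"
    and "global_sink G s"
    and "rotor_order G nxt"
    and "\<rho> \<in> acyclic_rotor_configs G"
  shows "(\<forall>\<rho>' \<in> acyclic_rotor_configs G.
            \<exists>!\<sigma>. \<sigma> \<in> recurrent_configs G \<and> chip_action G s nxt \<sigma> \<rho> = \<rho>')
       \<and> bij_betw (\<lambda>\<sigma>. chip_action G s nxt \<sigma> \<rho>) (recurrent_configs G) (acyclic_rotor_configs G)
       \<and> (recurrent_identity G \<in> recurrent_configs G
          \<and> sandpile_class G (recurrent_identity G) = \<one>\<^bsub>sandpile_group G\<^esub>
          \<and> chip_action G s nxt (recurrent_identity G) \<rho> = \<rho>)"
proof -
  interpret fin_digraph G by fact
  interpret rotor_network G s nxt
    by unfold_locales fact+
  note bij = bij_betw_recurrent_acyclic[OF assms(4)]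
  have "\<forall>\<rho>' \<in> acyclic_rotor_configs G.
      \<exists>!\<sigma>. \<sigma> \<in> recurrent_configs G \<and> chip_action G s nxt \<sigma> \<rho> = \<rho>'"
  proof
    fix \<rho>' assume "\<rho>' \<in> acyclic_rotor_configs G"
    then obtain \<sigma> where "\<sigma> \<in> recurrent_configs G" "chip_action G s nxt \<sigma> \<rho> = \<rho>'"
      using ex_recurrent_between assms(4) by blast
    then show "\<exists>!\<sigma>. \<sigma> \<in> recurrent_configs G \<and> chip_action G s nxt \<sigma> \<rho> = \<rho>'"
      using bij_betw_imp_inj_on[OF bij] by (intro ex1I[of _ \<sigma>]) (auto dest: inj_onD)
  qed
  moreover obtain \<sigma> where \<sigma>: "\<sigma> \<in> recurrent_configs G" "chip_action G s nxt \<sigma> \<rho> = \<rho>"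
    using ex_recurrent_between assms(4) by blast
  ultimately show ?thesis
    using bij recurrent_identity_eq[OF assms(4) \<sigma>] by simp
qed

end
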